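(* In the setting described in the context, let $G=T^n\langle\theta\rangle$, let $E$ be a minimal normal subgroup of $F^n{:}\langle\theta\rangle$ such that (1) $E\cong\mathbb{Z}_p^{2f}$, (2) $\langle\theta\rangle$ acts transitively on $E\setminus\{1\}$ by conjugation (so $E{:}\langle\theta\rangle\cong\mathrm{AGL}_1(q^2)$), and (3) $\pi_i(E)=F$ for all $i$ and $\ker(\pi_i)\cap E\ne\ker(\pi_j)\cap E$ for $1\leqslant i<j\leqslant n$; and let $H=E{:}\langle\theta\rangle$. Then $G$, acting by right multiplication on the set $[G:H]$ of right cosets of $H$, is a quasiprimitive group of non-diagonal PA type, where $T^n\cap H$ is a subdirect product of $(R\cap T)^n$.
   Context: Setting: (C1) $q=p^f$ for a prime $p$ and integer $f\geqslant1$, and $n:=q+1=2^sr^t>3$ where $t\geqslant0$, $r$ is an odd prime, and either $s\geqslant2$ or $q$ is even. (C2) $X$ is an almost simple group with socle $T$, $|X:T|\leqslant2$, and $X$ has a subgroup $R\cong\mathrm{AGL}_1(q)$, written $R=F{:}(\langle b\rangle\times\langle c\rangle)$ with $F\cong\mathbb{Z}_p^f$, $b$ of order $\frac{q-1}{\gcd(2,q-1)}$ and $c$ of order $\gcd(2,q-1)$. (C3) $\tau=(1,2,\ldots,n)\in S_n$ and $W=X\wr\langle\tau\rangle=X^n{:}\langle\tau\rangle$ with $\tau^{-1}(x_1,\ldots,x_n)\tau=(x_n,x_1,\ldots,x_{n-1})$. (C4) $\pi_i:(x_1,\ldots,x_n)\mapsto x_i$ are the projections $X^n\to X$. Put $\mathbf{d}_0=(bc,b,bc,\ldots,bc)\in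 R^n$ (second coordinate $b$, all others $bc$) and $\theta=\mathbf{d}_0\tau\in W$. A transitive permutation group $G$ is quasiprimitive of PA type if every minimal normal subgroup of $G$ is transitive, $G$ has a unique minimal normal subgroup $M=T_1\times\cdots\times T_n$ with $n\geqslant2$ and the $T_i$ pairwise isomorphic nonabelian simple groups, and for a point $\omega$ there are pairwise isomorphic subgroups $1\ne R_i<T_i$ with $M_\omega\leqslant R_1\times\cdots\times R_n$ projecting surjectively onto each $R_i$ (i.e. $M_\omega$ is a subdirect product of $R_1\times\cdots\times R_n$); it is non-diagonal if some projection $M_\omega\to R_i$ is not injective. *)

theory Defs
  imports "HOL-Algebra.Algebra" "HOL-Algebra.Multiplicative_Group"
    "HOL-Algebra.Elementary_Groups" "HOL-Algebra.Product_Groups" "HOL-Algebra.SimpleGroups"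
begin

text \<open>The affine group AGL_1 over a field K: maps x to a x + b (a nonzero),
  composed left to right.\<close>
definition AGL1 :: "('k, 'm) ring_scheme \<Rightarrow> ('k \<times> 'k) monoid" where
  "AGL1 K = \<lparr>carrier = {(a, b). a \<in> carrier K - {\<zero>\<^bsub>K\<^esub>} \<and> b \<in> carrier K},
     monoid.mult = (\<lambda>(a, b) (c, d). (c \<otimes>\<^bsub>K\<^esub> a, (c \<otimes>\<^bsub>K\<^esub> b) \<oplus>\<^bsub>K\<^esub> d)),
     one = (\<one>\<^bsub>K\<^esub>, \<zero>\<^bsub>K\<^esub>)\<rparr>"

definition elem_ab :: "nat \<Rightarrow> nat \<Rightarrow> (nat \<Rightarrow> int) monoid" where
  "elem_ab p k = product_group {..<k} (\<lambda>_. integer_mod_group p)"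

definition centralizer :: "('a, 'b) monoid_scheme \<Rightarrow> 'a set \<Rightarrow> 'a set" where
  "centralizer G S = {g \<in> carrier G. \<forall>s\<in>S. g \<otimes>\<^bsub>G\<^esub> s = s \<otimes>\<^bsub>G\<^esub> g}"

definition minimal_normal :: "('a, 'b) monoid_scheme \<Rightarrow> 'a set \<Rightarrow> bool" where
  "minimal_normal G N \<longleftrightarrow> normal N G \<and> N \<noteq> {\<one>\<^bsub>G\<^esub>} \<and>
     (\<forall>K. normal K G \<and> K \<subseteq> N \<longrightarrow> K = {\<one>\<^bsub>G\<^esub>} \<or> K = N)"

definition nonabelian_simple :: "('a, 'b) monoid_scheme \<Rightarrow> bool" where
  "nonabelian_simple G \<longleftrightarrow> simple_group G \<and> \<not> comm_group G"

text \<open>XG is almost simple with socle T: T is a nonabelian simple normal subgroup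
  of XG with trivial centraliser (so T \<le> XG \<le> Aut T).\<close>
definition almost_simple_socle :: "('a, 'b) monoid_scheme \<Rightarrow> 'a set \<Rightarrow> bool" where
  "almost_simple_socle XG T \<longleftrightarrow> group XG \<and> finite (carrier XG) \<and> normal T XG \<and>
     nonabelian_simple (XG\<lparr>carrier := T\<rparr>) \<and> centralizer XG T = {\<one>\<^bsub>XG\<^esub>}"

text \<open>The wreath product XG wr <tau>, tau = (1,...,n), with coordinates indexed by 0..n-1.
  The pair (x, k) stands for x tau^k; the multiplication realises
  tau^-1 (x_1,...,x_n) tau = (x_n, x_1, ..., x_(n-1)).\<close>
definition wreath_cyc :: "('a, 'b) monoid_scheme \<Rightarrow> nat \<Rightarrow> ((nat \<Rightarrow> 'a) \<times> nat) monoid" where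
  "wreath_cyc XG n = \<lparr>carrier = (({..<n} \<rightarrow>\<^sub>E carrier XG) \<times> {..<n}),
     monoid.mult = (\<lambda>(x, k) (y, l). ((\<lambda>i\<in>{..<n}. x i \<otimes>\<^bsub>XG\<^esub> y ((i + k) mod n)), (k + l) mod n)),
     one = ((\<lambda>i\<in>{..<n}. \<one>\<^bsub>XG\<^esub>), 0)\<rparr>"

definition lprod :: "('a, 'b) monoid_scheme \<Rightarrow> (nat \<Rightarrow> 'a) \<Rightarrow> nat \<Rightarrow> 'a" where
  "lprod G t k = foldr (\<lambda>i acc. t i \<otimes>\<^bsub>G\<^esub> acc) [0..<k] \<one>\<^bsub>G\<^esub>"

definition transitive_perm_group :: "('g, 'b) monoid_scheme \<Rightarrow> 'o set \<Rightarrow> ('o \<Rightarrow> 'g \<Rightarrow> 'o) \<Rightarrow> bool" where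
  "transitive_perm_group G \<Omega> act \<longleftrightarrow> group G \<and> \<Omega> \<noteq> {} \<and>
     (\<forall>\<omega>\<in>\<Omega>. \<forall>g\<in>carrier G. act \<omega> g \<in> \<Omega>) \<and>
     (\<forall>\<omega>\<in>\<Omega>. act \<omega> \<one>\<^bsub>G\<^esub> = \<omega>) \<and>
     (\<forall>\<omega>\<in>\<Omega>. \<forall>g\<in>carrier G. \<forall>h\<in>carrier G. act (act \<omega> g) h = act \<omega> (g \<otimes>\<^bsub>G\<^esub> h)) \<and>
     (\<forall>g\<in>carrier G. (\<forall>\<omega>\<in>\<Omega>. act \<omega> g = \<omega>) \<longrightarrow> g = \<one>\<^bsub>G\<^esub>) \<and>
     (\<forall>\<omega>\<in>\<Omega>. \<forall>\<omega>'\<in>\<Omega>. \<exists>g\<in>carrier G. act \<omega> g = \<omega>')"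

text \<open>Quasiprimitive of PA type, with the non-diagonal condition. M = T_0 x ... x T_(k-1)
  is expressed by: the product map from the external direct product of the T_i
  onto M is an isomorphism; projections M \<rightarrow> T_i are taken through its inverse.\<close>
definition quasiprimitive_nondiagonal_PA ::
  "('g, 'b) monoid_scheme \<Rightarrow> 'o set \<Rightarrow> ('o \<Rightarrow> 'g \<Rightarrow> 'o) \<Rightarrow> bool" where
  "quasiprimitive_nondiagonal_PA G \<Omega> act \<longleftrightarrow>
     transitive_perm_group G \<Omega> act \<and>
     (\<forall>N. minimal_normal G N \<longrightarrow> (\<forall>\<omega>\<in>\<Omega>. \<forall>\<omega>'\<in>\<Omega>. \<exists>g\<in>N. act \<omega> g = \<omega>')) \<and>
     (\<exists>M. minimal_normal G M \<and> (\<forall>N. minimal_normal G N \<longrightarrow> N = M) \<and>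
       (\<exists>(k::nat) Ts Rs. k \<ge> 2 \<and>
          (\<forall>i<k. subgroup (Ts i) G \<and> nonabelian_simple (G\<lparr>carrier := Ts i\<rparr>)) \<and>
          (\<forall>i<k. \<forall>j<k. G\<lparr>carrier := Ts i\<rparr> \<cong> G\<lparr>carrier := Ts j\<rparr>) \<and>
          (\<lambda>t. lprod G t k) \<in> iso (product_group {..<k} (\<lambda>i. G\<lparr>carrier := Ts i\<rparr>)) (G\<lparr>carrier := M\<rparr>) \<and>
          (\<exists>\<omega>\<in>\<Omega>.
             (\<forall>i<k. subgroup (Rs i) G \<and> Rs i \<subseteq> Ts i \<and> Rs i \<noteq> Ts i \<and> Rs i \<noteq> {\<one>\<^bsub>G\<^esub>}) \<and>
             (\<forall>i<k. \<forall>j<k. G\<lparr>carrier := Rs i\<rparr> \<cong> G\<lparr>carrier := Rs j\<rparr>) \<and>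
             {m \<in> M. act \<omega> m = \<omega>} \<subseteq> (\<lambda>t. lprod G t k) ` (\<Pi>\<^sub>E j\<in>{..<k}. Rs j) \<and>
             (\<forall>i<k. (\<lambda>m. inv_into (\<Pi>\<^sub>E j\<in>{..<k}. Ts j) (\<lambda>t. lprod G t k) m i)
                        ` {m \<in> M. act \<omega> m = \<omega>} = Rs i) \<and>
             (\<exists>i<k. \<not> inj_on (\<lambda>m. inv_into (\<Pi>\<^sub>E j\<in>{..<k}. Ts j) (\<lambda>t. lprod G t k) m i)
                        {m \<in> M. act \<omega> m = \<omega>}))))"

end

theory Submission
  imports Defs
begin

text \<open>
  The abelian normal subgroup F of R consists of the translations of AGL_1(q), which are commutators
  since q > 2; as T has index at most 2 in X, this forces F \<le> T, hence E \<le> F^n \<le> T^n. The n-th power of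
  \<theta> is the diagonal element with entry b^2 c, and b^2 c generates \<langle>b\<rangle> \<times> \<langle>c\<rangle> because the order of b is odd;
  therefore E and the powers of \<theta>^n project T^n \<inter> H onto R \<inter> T in every coordinate. Commutators with
  elements supported on one coordinate, together with the simplicity of T and the cyclic shift by \<theta>,
  show that every nontrivial normal subgroup of G contains T^n. Hence T^n is the unique minimal
  normal subgroup, H is core-free since R \<inter> T < T, and G = T^n H gives transitivity. Finally the
  kernels of two distinct projections of E differ, so they are not both trivial.
\<close>

section \<open>Coset actions, commutators and affine groups\<close>

text \<open>The deviating entry of \<open>d0\<close> is there to keep c. Once around the cycle, the
  entries of \<theta> multiply to b^n c^(n-1) in every coordinate, with n = q + 1. For even q, c is
  trivial and nothing can be lost. For odd q, n is even, so the constant vector with entry bc would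
  give b^n c^n = b^2, and c would disappear; leaving it out of one coordinate makes its exponent n -
  1 = q, which is odd. The factor b^n is b^2 because b^(q-1) = 1. The order of b is odd for a
  different reason in each case: it is q - 1 when q is even, while for odd q the condition s \<ge> 2
  gives 4 | q + 1, so that (q-1)/2 is odd.

  The other difficulty is that X may exceed T. The entries of \<theta> and of elements of G lie in X
  only, so the point stabiliser in T^n projects onto \<open>R \<inter> T\<close> instead of R, and
  the commutator argument needs the centraliser of T in X to be trivial, not just the centre of T.

  That E lies in the base group is not part of the hypotheses either: E is only given as a minimal
  normal subgroup of a group containing \<theta>, and this has to be derived from
  minimality.\<close>

lemma (in group) normal_conj_closed:
  assumes "subgroup S G" "N \<lhd> (G\<lparr>carrier := S\<rparr>)" "x \<in> S" "h \<in> N"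
  shows "x \<otimes> h \<otimes> inv x \<in> N"
  using group.normal_inv_iff[OF subgroup_imp_group[OF assms(1)], of N] assms by auto

lemma (in group) transitive_perm_group_rcosets:
  assumes H: "subgroup H G"
    and core: "\<And>N. N \<lhd> G \<Longrightarrow> N \<subseteq> H \<Longrightarrow> N = {\<one>}"
  shows "transitive_perm_group G (rcosets H) (\<lambda>S g. S #> g)"
proof -
  note Hc = subgroup.subset[OF H]
  have cl: "S #> g \<in> rcosets H" if "S \<in> rcosets H" "g \<in> carrier G" for S g
    using that Hc by (auto simp: RCOSETS_def coset_mult_assoc)
  have one: "S #> \<one> = S" if "S \<in> rcosets H" for S
    using that Hc by (auto simp: RCOSETS_def coset_mult_assoc)
  have assoc: "(S #> g) #> h = S #> (g \<otimes> h)"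
    if "S \<in> rcosets H" "g \<in> carrier G" "h \<in> carrier G" for S g h
    using that by (simp add: coset_mult_assoc subgroup.rcosets_carrier[OF H is_group])
  have trans: "\<exists>g\<in>carrier G. S #> g = S'" if S: "S \<in> rcosets H" "S' \<in> rcosets H" for S S'
  proof -
    obtain x y where xy: "x \<in> carrier G" "y \<in> carrier G" "S = H #> x" "S' = H #> y"
      using S by (auto simp: RCOSETS_def)
    then have "S #> (inv x \<otimes> y) = S'"
      using Hc by (simp add: coset_mult_assoc flip: m_assoc)
    then show ?thesis using xy by blast
  qed
  \<comment> \<open>C is the core of H, the intersection of its conjugates. An element fixing every
    coset lies in C, so faithfulness reduces to the hypothesis on normal subgroups inside H.\<close>
  define C where "C = {g \<in> carrier G. \<forall>x\<in>carrier G. x \<otimes> g \<otimes> inv x \<in> H}"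
  have CH: "C \<subseteq> H"
  proof
    fix g assume "g \<in> C"
    then have "g \<in> carrier G" "\<one> \<otimes> g \<otimes> inv \<one> \<in> H" unfolding C_def by blast+
    then show "g \<in> H" by simp
  qed
  have "subgroup C G"
  proof (rule subgroupI)
    show "C \<subseteq> carrier G" by (auto simp: C_def)
    have "\<one> \<in> C" using subgroup.one_closed[OF H] by (simp add: C_def)
    then show "C \<noteq> {}" by blast
  next
    fix a assume a: "a \<in> C"
    then have ac: "a \<in> carrier G" by (simp add: C_def)
    have "x \<otimes> inv a \<otimes> inv x \<in> H" if x: "x \<in> carrier G" for x
    proof -
      have "inv (x \<otimes> a \<otimes> inv x) \<in> H"
        using a x subgroup.m_inv_closed[OF H] by (auto simp: C_def)
      then show ?thesis using x ac by (simp add: inv_mult_group m_assoc)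
    qed
    then show "inv a \<in> C" using ac by (simp add: C_def)
  next
    fix a b' assume ab: "a \<in> C" "b' \<in> C"
    then have c: "a \<in> carrier G" "b' \<in> carrier G" by (auto simp: C_def)
    have "x \<otimes> (a \<otimes> b') \<otimes> inv x \<in> H" if x: "x \<in> carrier G" for x
    proof -
      have "(x \<otimes> a \<otimes> inv x) \<otimes> (x \<otimes> b' \<otimes> inv x) \<in> H"
        using ab x subgroup.m_closed[OF H] by (auto simp: C_def)
      moreover have "(x \<otimes> a \<otimes> inv x) \<otimes> (x \<otimes> b' \<otimes> inv x) = x \<otimes> (a \<otimes> b') \<otimes> inv x"
        using x c by (simp add: m_assoc inv_solve_left')
      ultimately show ?thesis by simp
    qed
    then show "a \<otimes> b' \<in> C" using c by (simp add: C_def)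
  qed
  moreover have "x \<otimes> h \<otimes> inv x \<in> C" if x: "x \<in> carrier G" and h: "h \<in> C" for x h
  proof -
    have hc: "h \<in> carrier G" using h by (simp add: C_def)
    have "y \<otimes> (x \<otimes> h \<otimes> inv x) \<otimes> inv y \<in> H" if y: "y \<in> carrier G" for y
    proof -
      have "(y \<otimes> x) \<otimes> h \<otimes> inv (y \<otimes> x) \<in> H" using h x y by (auto simp: C_def)
      then show ?thesis using x y hc by (simp add: inv_mult_group m_assoc)
    qed
    then show ?thesis using x hc by (simp add: C_def)
  qed
  ultimately have "C \<lhd> G" by (simp add: normal_inv_iff)
  then have C1: "C = {\<one>}" using core CH by blast
  have faith: "g = \<one>" if g: "g \<in> carrier G" and fx: "\<forall>S\<in>rcosets H. S #> g = S" for g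
  proof -
    have "x \<otimes> g \<otimes> inv x \<in> H" if x: "x \<in> carrier G" for x
    proof -
      have "H #> x #> g = H #> x" using fx rcosetsI[OF Hc x] by blast
      then have "H #> (x \<otimes> g \<otimes> inv x) = H"
        using x g Hc by (simp add: coset_mult_assoc coset_mult_inv2)
      then show ?thesis using coset_join1[OF _ _ H] x g by simp
    qed
    then have "g \<in> C" using g by (simp add: C_def)
    then show ?thesis using C1 by simp
  qed
  have "rcosets H \<noteq> {}" by (auto simp: RCOSETS_def)
  then show ?thesis unfolding transitive_perm_group_def
    using cl one assoc trans faith group_axioms by (intro conjI ballI impI) simp_all
qed

text \<open>A quotient of order at most 2 is abelian, so it kills the commutator g. Counting
  replaces the quotient: two elements u, v outside T have their product in T, since otherwise T, Tv
  and Tuv would be three disjoint cosets. So either normality of T applies directly, or both xy and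
  yx lie in T.\<close>

lemma (in group) index_two_commutator_mem:
  assumes T: "T \<lhd> G" and fin: "finite (carrier G)" and idx: "card (carrier G) \<le> 2 * card T"
    and xy: "x \<in> carrier G" "y \<in> carrier G" "g \<in> carrier G" and eq: "x \<otimes> y = g \<otimes> (y \<otimes> x)"
  shows "g \<in> T"
proof -
  interpret T: normal T G by fact
  have g: "g = x \<otimes> y \<otimes> inv x \<otimes> inv y"
    using xy by (simp add: eq m_assoc)
  show ?thesis
  proof (cases "x \<in> T \<or> y \<in> T")
    case True
    then show ?thesis
    proof
      assume "x \<in> T"
      then have "x \<otimes> (y \<otimes> inv x \<otimes> inv y) \<in> T"
        using xy T.inv_op_closed2[of y "inv x"] by auto
      then show ?thesis using xy by (simp add: g m_assoc)
    next
      assume "y \<in> T"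
      then have "(x \<otimes> y \<otimes> inv x) \<otimes> inv y \<in> T"
        using xy T.inv_op_closed2[of x y] by auto
      then show ?thesis using xy by (simp add: g m_assoc)
    qed
  next
    case False
    have two: "u \<otimes> v \<in> T" if u: "u \<in> carrier G" "u \<notin> T" and v: "v \<in> carrier G" "v \<notin> T" for u v
    proof (rule ccontr)
      assume n: "u \<otimes> v \<notin> T"
      have i1: "inj_on (\<lambda>t. t \<otimes> v) T" using v by (auto intro!: inj_onI)
      have i2: "inj_on (\<lambda>t. t \<otimes> (u \<otimes> v)) T" using u v by (auto intro!: inj_onI)
      let ?B = "(\<lambda>t. t \<otimes> v) ` T" and ?C = "(\<lambda>t. t \<otimes> (u \<otimes> v)) ` T"
      have nt: "t \<otimes> w \<notin> T" if "t \<in> T" "w \<in> carrier G" "w \<notin> T" for t w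
      proof
        assume "t \<otimes> w \<in> T"
        then have "inv t \<otimes> (t \<otimes> w) \<in> T" using that by blast
        then show False using that by (simp flip: m_assoc)
      qed
      have "T \<inter> ?B = {}" "T \<inter> ?C = {}" using nt u v n by auto
      moreover have "?B \<inter> ?C = {}"
      proof -
        have False if t: "t \<in> T" "t' \<in> T" "t \<otimes> v = t' \<otimes> (u \<otimes> v)" for t t'
        proof -
          have "t = t' \<otimes> u" using t u v by (simp flip: m_assoc)
          then show False using nt[of t' u] t u by simp
        qed
        then show ?thesis by blast
      qed
      moreover have "finite T" using fin T.subset finite_subset by blast
      ultimately have "card (T \<union> ?B \<union> ?C) = 3 * card T"
        by (subst card_Un_disjoint, auto simp: card_image[OF i1] card_image[OF i2])
           (subst card_Un_disjoint, auto simp: card_image[OF i1])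
      moreover have "card (T \<union> ?B \<union> ?C) \<le> card (carrier G)"
        using fin u v T.subset by (intro card_mono) auto
      moreover have "card T > 0" using \<open>finite T\<close> T.one_closed card_gt_0_iff by blast
      ultimately show False using idx by simp
    qed
    have "x \<otimes> y \<in> T" "y \<otimes> x \<in> T" using two False xy by auto
    then have "(x \<otimes> y) \<otimes> inv (y \<otimes> x) \<in> T" by blast
    then show ?thesis using xy by (simp add: g inv_mult_group m_assoc)
  qed
qed

text \<open>An abelian normal subgroup of the affine group consists of translations, and once the field has
  a scalar besides 0 and 1 every translation is a commutator.\<close>

lemma (in group) abelian_normal_AGL1_commutator:
  fixes K :: "('k, 'm) ring_scheme"
  assumes R: "subgroup R G" and K: "field K" and cardK: "card (carrier K) > 2"
    and iso: "G\<lparr>carrier := R\<rparr> \<cong> AGL1 K"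
    and F: "F \<lhd> (G\<lparr>carrier := R\<rparr>)" and comm: "\<And>x y. x \<in> F \<Longrightarrow> y \<in> F \<Longrightarrow> x \<otimes> y = y \<otimes> x"
    and g: "g \<in> F"
  shows "\<exists>x\<in>R. \<exists>y\<in>R. x \<otimes> y = g \<otimes> (y \<otimes> x)"
proof -
  interpret K: field K by fact
  obtain \<phi> where \<phi>: "\<phi> \<in> iso (G\<lparr>carrier := R\<rparr>) (AGL1 K)" using iso by (auto simp: is_iso_def)
  have mult: "\<phi> (x \<otimes> y) = \<phi> x \<otimes>\<^bsub>AGL1 K\<^esub> \<phi> y" if "x \<in> R" "y \<in> R" for x y
    using \<phi> that by (simp add: iso_def hom_def)
  have bij: "bij_betw \<phi> R (carrier (AGL1 K))" using \<phi> by (simp add: iso_def)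
  have FR: "F \<subseteq> R" using normal_imp_subgroup[OF F] subgroup.subset by fastforce
  have Rc: "R \<subseteq> carrier G" using subgroup.subset[OF R] .
  have pre: "\<exists>x\<in>R. \<phi> x = (u, v)" if "u \<in> carrier K - {\<zero>\<^bsub>K\<^esub>}" "v \<in> carrier K" for u v
  proof -
    have "(u, v) \<in> carrier (AGL1 K)" using that by (simp add: AGL1_def)
    then show ?thesis using bij_betw_imp_surj_on[OF bij] by (metis imageE)
  qed
  have form: "\<exists>u v. \<phi> x = (u, v) \<and> u \<in> carrier K \<and> u \<noteq> \<zero>\<^bsub>K\<^esub> \<and> v \<in> carrier K" if "x \<in> R" for x
    using bij_betw_apply[OF bij that] by (auto simp: AGL1_def)
  obtain a b' where ab: "\<phi> g = (a, b')" "a \<in> carrier K" "a \<noteq> \<zero>\<^bsub>K\<^esub>" "b' \<in> carrier K"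
    using form g FR by blast
  obtain u where u: "u \<in> R" "\<phi> u = (\<one>\<^bsub>K\<^esub>, \<one>\<^bsub>K\<^esub>)" using pre by force
  \<comment> \<open>Conjugating g = (a, b') by the translation by 1 gives h = (a, a + b' - 1). As h
    is again in the abelian group F, it commutes with g, and this says exactly (a - 1)^2 = 0; hence
    g is a translation.\<close>
  define h where "h = u \<otimes> g \<otimes> inv u"
  have hF: "h \<in> F" unfolding h_def using normal_conj_closed[OF R F u(1) g] .
  have hu: "h \<otimes> u = u \<otimes> g" using u g FR Rc by (auto simp: h_def m_assoc subset_iff)
  obtain a2 b2 where ab2: "\<phi> h = (a2, b2)" "a2 \<in> carrier K" "b2 \<in> carrier K"
    using form hF FR by blast
  have "\<phi> h \<otimes>\<^bsub>AGL1 K\<^esub> \<phi> u = \<phi> u \<otimes>\<^bsub>AGL1 K\<^esub> \<phi> g"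
    using hu mult hF g FR u by (metis subsetD)
  then have e1: "a2 = a" "b2 \<oplus>\<^bsub>K\<^esub> \<one>\<^bsub>K\<^esub> = a \<oplus>\<^bsub>K\<^esub> b'"
    using ab ab2 u by (auto simp: AGL1_def)
  have "\<phi> h \<otimes>\<^bsub>AGL1 K\<^esub> \<phi> g = \<phi> g \<otimes>\<^bsub>AGL1 K\<^esub> \<phi> h"
    using comm mult hF g FR by (metis subsetD)
  then have e2: "a \<otimes>\<^bsub>K\<^esub> b2 \<oplus>\<^bsub>K\<^esub> b' = a \<otimes>\<^bsub>K\<^esub> b' \<oplus>\<^bsub>K\<^esub> b2"
    using ab ab2 e1 by (auto simp: AGL1_def)
  have b2: "b2 = a \<oplus>\<^bsub>K\<^esub> b' \<ominus>\<^bsub>K\<^esub> \<one>\<^bsub>K\<^esub>"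
    using e1 ab ab2 by (metis K.add.inv_solve_right K.add.m_closed K.minus_eq K.one_closed)
  have "(a \<ominus>\<^bsub>K\<^esub> \<one>\<^bsub>K\<^esub>) \<otimes>\<^bsub>K\<^esub> (a \<ominus>\<^bsub>K\<^esub> \<one>\<^bsub>K\<^esub>)
      = (a \<otimes>\<^bsub>K\<^esub> b2 \<oplus>\<^bsub>K\<^esub> b') \<ominus>\<^bsub>K\<^esub> (a \<otimes>\<^bsub>K\<^esub> b' \<oplus>\<^bsub>K\<^esub> b2)"
    unfolding b2 using ab(2,4) by algebra
  also have "\<dots> = \<zero>\<^bsub>K\<^esub>" unfolding e2 using ab ab2 by (simp add: K.minus_eq K.r_neg)
  finally have "a \<ominus>\<^bsub>K\<^esub> \<one>\<^bsub>K\<^esub> = \<zero>\<^bsub>K\<^esub>" using ab K.integral by blast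
  then have a1: "a = \<one>\<^bsub>K\<^esub>" using ab by (simp add: K.r_right_minus_eq)
  have "\<not> carrier K \<subseteq> {\<zero>\<^bsub>K\<^esub>, \<one>\<^bsub>K\<^esub>}"
  proof
    assume "carrier K \<subseteq> {\<zero>\<^bsub>K\<^esub>, \<one>\<^bsub>K\<^esub>}"
    then have "card (carrier K) \<le> card {\<zero>\<^bsub>K\<^esub>, \<one>\<^bsub>K\<^esub>}" by (intro card_mono) auto
    also have "\<dots> \<le> 2" by (simp add: card_insert_if)
    finally show False using cardK by simp
  qed
  then obtain z where z: "z \<in> carrier K" "z \<noteq> \<zero>\<^bsub>K\<^esub>" "z \<noteq> \<one>\<^bsub>K\<^esub>" by blast
  define y0 where "y0 = \<one>\<^bsub>K\<^esub> \<ominus>\<^bsub>K\<^esub> z"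
  have y0: "y0 \<in> carrier K" "y0 \<noteq> \<zero>\<^bsub>K\<^esub>" using z K.r_right_minus_eq[of "\<one>\<^bsub>K\<^esub>" z] by (auto simp: y0_def)
  have i0: "inv\<^bsub>K\<^esub> y0 \<in> carrier K" "y0 \<otimes>\<^bsub>K\<^esub> inv\<^bsub>K\<^esub> y0 = \<one>\<^bsub>K\<^esub>"
    using y0 K.field_Units by auto
  \<comment> \<open>For x = (z, 0) and y = (1, w), the equation xy = g(yx) amounts to z(b' + w) = w.
    The choice w = zb'/(1 - z) solves it, and this is where a scalar z different from 1 is
    needed.\<close>
  define w where "w = (z \<otimes>\<^bsub>K\<^esub> b') \<otimes>\<^bsub>K\<^esub> inv\<^bsub>K\<^esub> y0"
  have w: "w \<in> carrier K" using z ab i0 by (simp add: w_def)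
  have "(\<one>\<^bsub>K\<^esub> \<ominus>\<^bsub>K\<^esub> z) \<otimes>\<^bsub>K\<^esub> w = (z \<otimes>\<^bsub>K\<^esub> b') \<otimes>\<^bsub>K\<^esub> (y0 \<otimes>\<^bsub>K\<^esub> inv\<^bsub>K\<^esub> y0)"
    unfolding w_def y0_def[symmetric] using y0 i0(1) z ab by (simp add: K.m_ac)
  then have y0w: "(\<one>\<^bsub>K\<^esub> \<ominus>\<^bsub>K\<^esub> z) \<otimes>\<^bsub>K\<^esub> w = z \<otimes>\<^bsub>K\<^esub> b'" using i0 z ab by simp
  have "z \<otimes>\<^bsub>K\<^esub> (b' \<oplus>\<^bsub>K\<^esub> w) = z \<otimes>\<^bsub>K\<^esub> b' \<oplus>\<^bsub>K\<^esub> z \<otimes>\<^bsub>K\<^esub> w" using z ab w by algebra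
  also have "\<dots> = w" unfolding y0w[symmetric] using z w by algebra
  finally have key: "z \<otimes>\<^bsub>K\<^esub> (b' \<oplus>\<^bsub>K\<^esub> w) = w" .
  obtain x where x: "x \<in> R" "\<phi> x = (z, \<zero>\<^bsub>K\<^esub>)" using pre[of z "\<zero>\<^bsub>K\<^esub>"] z by auto
  obtain y where y: "y \<in> R" "\<phi> y = (\<one>\<^bsub>K\<^esub>, w)" using pre[of "\<one>\<^bsub>K\<^esub>" w] w by auto
  have cl: "u \<otimes> v \<in> R" if "u \<in> R" "v \<in> R" for u v using subgroup.m_closed[OF R] that by blast
  have "\<phi> (x \<otimes> y) = \<phi> x \<otimes>\<^bsub>AGL1 K\<^esub> \<phi> y" using mult x y by blast
  also have "\<dots> = (z, w)" using x y z w by (simp add: AGL1_def)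
  also have "\<dots> = \<phi> g \<otimes>\<^bsub>AGL1 K\<^esub> (\<phi> y \<otimes>\<^bsub>AGL1 K\<^esub> \<phi> x)"
    using x y z w ab a1 key by (simp add: AGL1_def K.r_distr)
  also have "\<dots> = \<phi> (g \<otimes> (y \<otimes> x))" using mult x y g FR cl by (metis subsetD)
  finally have "x \<otimes> y = g \<otimes> (y \<otimes> x)"
    using bij cl x y g FR unfolding bij_betw_def inj_on_def by blast
  then show ?thesis using x y by blast
qed

text \<open>The exponents are n and n - 1 for n = q + 1, as they occur in the n-th power of
  \<theta>. Since b^(q-1) = 1, the generator y equals b^2 c^q. For even q, c = 1 and y^(q/2) = b^q =
  b. For odd q, m = (q-1)/2 is odd with b^m = 1 and c^2 = 1, so y = b^2 c and y^m = c; then b^2 is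
  recovered as y times the inverse of c, and b is the power of b^2 with exponent (m+1)/2.\<close>

lemma (in group) generate_pair_subset_generate_mult:
  assumes b: "b \<in> carrier G" and c: "c \<in> carrier G" and comm: "b \<otimes> c = c \<otimes> b"
    and ordb: "ord b = (q - 1) div gcd 2 (q - 1)" and ordc: "ord c = gcd 2 (q - 1)"
    and q: "q > 0" "even q \<or> 4 dvd q + 1"
  shows "generate G {b, c} \<subseteq> generate G {b [^] (q + 1) \<otimes> c [^] q}"
proof -
  define y where "y = b [^] (q + 1) \<otimes> c [^] q"
  have y: "y \<in> carrier G" using b c by (simp add: y_def)
  interpret D: subgroup "generate G {y}" G using generate_is_subgroup[of "{y}"] y by simp
  have yD: "y \<in> generate G {y}" by (simp add: generate.incl)
  have pD: "x [^] (k::nat) \<in> generate G {y}" if "x \<in> generate G {y}" for x k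
    using that by (induction k) auto
  have "ord b dvd q - 1" unfolding ordb by (rule div_dvd_iff_mult[THEN iffD2]) auto
  then have b1: "b [^] (q - 1) = \<one>" using b pow_eq_id by blast
  have "b [^] (q + 1) = b [^] (q - 1) \<otimes> b [^] (2::nat)"
    using b q by (simp add: nat_pow_mult)
  then have b2: "b [^] (q + 1) = b [^] (2::nat)" using b1 b by simp
  have bq: "b [^] q = b" 
  proof -
    have "b [^] Suc (q - 1) = b" using b1 b by simp
    then show ?thesis using q by simp
  qed
  have "b \<in> generate G {y} \<and> c \<in> generate G {y}"
  proof (cases "even q")
    case True
    then have "odd (q - 1)" using q by simp
    then have "gcd 2 (q - 1) = 1" by (intro coprime_imp_gcd_eq_1) (simp only: coprime_left_2_iff_odd not_False_eq_True)
    then have "ord c = 1" using ordc by simp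
    then have c1: "c = \<one>" using pow_ord_eq_1[OF c] c by simp
    then have "y = b [^] (2::nat)" unfolding y_def b2 using b by simp
    then have "y [^] (q div 2) = b" using True b bq by (simp add: nat_pow_pow)
    then show ?thesis using pD[OF yD, of "q div 2"] c1 by simp
  next
    case False
    then have "2 dvd q - 1" by simp
    then have g2: "gcd 2 (q - 1) = 2" by (rule gcd_nat.absorb1)
    define m where "m = (q - 1) div 2"
    have m: "q = 2 * m + 1" "odd m"
    proof -
      show q': "q = 2 * m + 1" using False q by (simp add: m_def) 
      have "4 dvd q + 1" using False q(2) by blast
      then show "odd m" using q' by presburger
    qed
    have bm: "b [^] m = \<one>" using pow_ord_eq_1[OF b] ordb g2 by (simp add: m_def)
    have c2: "c [^] (2::nat) = \<one>" using pow_ord_eq_1[OF c] ordc g2 by simp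
    have codd: "c [^] k = c" if "odd k" for k :: nat
    proof -
      obtain j where "k = 2 * j + 1" using \<open>odd k\<close> by (rule oddE)
      then have "c [^] k = (c [^] (2::nat)) [^] j \<otimes> c" using c by (simp add: nat_pow_pow)
      then show ?thesis using c2 c by simp
    qed
    have cm: "b [^] (2::nat) \<otimes> c = c \<otimes> b [^] (2::nat)"
    proof -
      have "b \<otimes> b \<otimes> c = b \<otimes> c \<otimes> b" by (metis b c comm m_assoc)
      also have "\<dots> = c \<otimes> (b \<otimes> b)" by (metis b c comm m_assoc)
      finally show ?thesis using b by (simp add: numeral_2_eq_2)
    qed
    have y2: "y = b [^] (2::nat) \<otimes> c" unfolding y_def b2 codd[OF False] ..
    have "y [^] m = (b [^] (2::nat)) [^] m \<otimes> c [^] m"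
      unfolding y2 using pow_mult_distrib[OF cm] b c by simp
    also have "(b [^] (2::nat)) [^] m = (b [^] m) [^] (2::nat)"
      using b by (simp add: nat_pow_pow mult.commute)
    finally have "y [^] m = c" using bm codd[OF m(2)] c by simp
    then have cD: "c \<in> generate G {y}" using pD[OF yD, of m] by simp
    have "b [^] (2::nat) = y \<otimes> inv c" using b c by (simp add: y2 m_assoc)
    then have b2D: "b [^] (2::nat) \<in> generate G {y}" using cD yD by simp
    obtain j where "m = 2 * j + 1" using m(2) by (rule oddE)
    then have "2 * (j + 1) = m + 1" by simp
    then have "(b [^] (2::nat)) [^] (j + 1) = b [^] (m + 1)" by (simp only: nat_pow_pow[OF b])
    also have "\<dots> = b" using bm b by simp
    finally show ?thesis using pD[OF b2D, of "j + 1"] cD by simp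
  qed
  then show ?thesis unfolding y_def[symmetric]
    by (intro generate_subgroup_incl D.subgroup_axioms) simp
qed

section \<open>Elementary abelian groups and rotations of indices\<close>

lemma comm_group_elem_ab: "comm_group (elem_ab p k)"
proof -
  interpret Z: comm_group "integer_mod_group p" by simp
  have "group (elem_ab p k)" unfolding elem_ab_def by (intro product_group Z.group_axioms)
  then show ?thesis
  proof (rule group.group_comm_groupI)
    fix x y assume "x \<in> carrier (elem_ab p k)" "y \<in> carrier (elem_ab p k)"
    then have "x i \<otimes>\<^bsub>integer_mod_group p\<^esub> y i = y i \<otimes>\<^bsub>integer_mod_group p\<^esub> x i" if "i < k" for i
      using that by (intro Z.m_comm) (auto simp: elem_ab_def)
    then show "x \<otimes>\<^bsub>elem_ab p k\<^esub> y = y \<otimes>\<^bsub>elem_ab p k\<^esub> x"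
      by (simp add: elem_ab_def fun_eq_iff restrict_def)
  qed
qed

lemma iso_comm_group_imp_commute:
  assumes iso: "G \<cong> A" and A: "comm_group A" and x: "x \<in> carrier G" and y: "y \<in> carrier G"
    and cl: "x \<otimes>\<^bsub>G\<^esub> y \<in> carrier G" "y \<otimes>\<^bsub>G\<^esub> x \<in> carrier G"
  shows "x \<otimes>\<^bsub>G\<^esub> y = y \<otimes>\<^bsub>G\<^esub> x"
proof -
  interpret A: comm_group A by fact
  obtain \<phi> where \<phi>: "\<phi> \<in> hom G A" "bij_betw \<phi> (carrier G) (carrier A)" using iso by (auto simp: is_iso_def iso_def)
  have "\<phi> (x \<otimes>\<^bsub>G\<^esub> y) = \<phi> x \<otimes>\<^bsub>A\<^esub> \<phi> y" using \<phi>(1) x y by (simp add: hom_def)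
  also have "\<dots> = \<phi> y \<otimes>\<^bsub>A\<^esub> \<phi> x" using \<phi>(1) x y by (intro A.m_comm) (auto simp: hom_def)
  also have "\<dots> = \<phi> (y \<otimes>\<^bsub>G\<^esub> x)" using \<phi>(1) x y by (simp add: hom_def)
  finally show ?thesis using \<phi>(2) cl by (auto simp: bij_betw_def inj_on_def)
qed

text \<open>The source of injectivity for rotations of indices, used both to reindex sums and to see
  that conjugation keeps an element supported on one coordinate.\<close>

lemma add_mod_add_eq_zero_imp_mod_eq:
  fixes i k l n :: nat
  assumes "i < n" "(k + l) mod n = 0"
  shows "((i + k) mod n + l) mod n = i"
proof -
  have "((i + k) mod n + l) mod n = (i + (k + l) mod n) mod n"
    by (simp add: mod_simps add.assoc)
  then show ?thesis using assms by simp
qed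

lemma sum_shift_mod:
  fixes f :: "nat \<Rightarrow> nat"
  assumes "i < n"
  shows "(\<Sum>l<n. f ((i + l) mod n)) = (\<Sum>j<n. f j)"
proof -
  have "inj_on (\<lambda>l. (i + l) mod n) {..<n}"
  proof (rule inj_on_inverseI[of _ "\<lambda>j. (j + (n - i)) mod n"])
    fix l assume "l \<in> {..<n}"
    then show "((i + l) mod n + (n - i)) mod n = l"
      using add_mod_add_eq_zero_imp_mod_eq[of l n i "n - i"] assms by (simp add: add.commute)
  qed
  moreover have "(\<lambda>l. (i + l) mod n) ` {..<n} \<subseteq> {..<n}" using assms by auto
  ultimately have "bij_betw (\<lambda>l. (i + l) mod n) {..<n} {..<n}"
    by (simp add: bij_betw_def endo_inj_surj)
  then show ?thesis by (rule sum.reindex_bij_betw)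
qed

section \<open>Cyclic wreath products\<close>

lemma lprod_carrier_update [simp]: "lprod (G\<lparr>carrier := S\<rparr>) = lprod G"
  by (simp add: lprod_def fun_eq_iff)

locale cyclic_wreath = group XG for XG :: "('a, 'b) monoid_scheme" (structure) +
  fixes n :: nat
  assumes n_pos: "n > 0"
begin

abbreviation "W \<equiv> wreath_cyc XG n"

definition base :: "'a set \<Rightarrow> ((nat \<Rightarrow> 'a) \<times> nat) set" where
  "base A = ({..<n} \<rightarrow>\<^sub>E A) \<times> {0}"

definition single :: "nat \<Rightarrow> 'a \<Rightarrow> (nat \<Rightarrow> 'a) \<times> nat" where
  "single i a = ((\<lambda>j\<in>{..<n}. if j = i then a else \<one>), 0)"

lemma carrier_wreath: "carrier W = ({..<n} \<rightarrow>\<^sub>E carrier XG) \<times> {..<n}"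
  by (simp add: wreath_cyc_def)

lemma mult_wreath:
  "(x, k) \<otimes>\<^bsub>W\<^esub> (y, l) = ((\<lambda>i\<in>{..<n}. x i \<otimes> y ((i + k) mod n)), (k + l) mod n)"
  by (simp add: wreath_cyc_def)

lemma one_wreath: "\<one>\<^bsub>W\<^esub> = ((\<lambda>i\<in>{..<n}. \<one>), 0)"
  by (simp add: wreath_cyc_def)

lemma fst_mult_wreath: "i < n \<Longrightarrow> fst (g \<otimes>\<^bsub>W\<^esub> h) i = fst g i \<otimes> fst h ((i + snd g) mod n)"
  by (cases g; cases h) (simp add: mult_wreath)

lemma snd_mult_wreath: "snd (g \<otimes>\<^bsub>W\<^esub> h) = (snd g + snd h) mod n"
  by (cases g; cases h) (simp add: mult_wreath)

lemma fst_wreath_closed: "g \<in> carrier W \<Longrightarrow> i < n \<Longrightarrow> fst g i \<in> carrier XG"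
  unfolding carrier_wreath mem_Times_iff by (blast intro: PiE_mem)

lemma snd_wreath_less: "g \<in> carrier W \<Longrightarrow> snd g < n"
  unfolding carrier_wreath by (cases g) simp

lemma wreath_eqI:
  assumes "g \<in> carrier W" "h \<in> carrier W" "\<And>i. i < n \<Longrightarrow> fst g i = fst h i" "snd g = snd h"
  shows "g = h"
proof (rule prod_eqI)
  show "fst g = fst h"
    using assms by (intro PiE_ext[of _ "{..<n}" "\<lambda>_. carrier XG"]) (auto simp: carrier_wreath)
qed fact

lemma group_wreath: "group W"
proof (rule groupI)
  show "\<one>\<^bsub>W\<^esub> \<in> carrier W" using n_pos by (simp add: one_wreath carrier_wreath)
next
  fix g h assume gh: "g \<in> carrier W" "h \<in> carrier W"
  obtain x k y l where e: "g = (x, k)" "h = (y, l)" by (cases g; cases h)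
  have x: "x i \<in> carrier XG" if "i < n" for i
    using gh that by (auto simp: e carrier_wreath)
  have y: "y i \<in> carrier XG" if "i < n" for i
    using gh that by (auto simp: e carrier_wreath)
  show "g \<otimes>\<^bsub>W\<^esub> h \<in> carrier W"
    unfolding e mult_wreath carrier_wreath using x y n_pos by simp
next
  fix g h j assume ghj: "g \<in> carrier W" "h \<in> carrier W" "j \<in> carrier W"
  obtain x k y l z m where e: "g = (x, k)" "h = (y, l)" "j = (z, m)"
    by (cases g; cases h; cases j)
  have "x i \<in> carrier XG" "y i \<in> carrier XG" "z i \<in> carrier XG" if "i < n" for i
    using ghj that by (auto simp: e carrier_wreath)
  then show "g \<otimes>\<^bsub>W\<^esub> h \<otimes>\<^bsub>W\<^esub> j = g \<otimes>\<^bsub>W\<^esub> (h \<otimes>\<^bsub>W\<^esub> j)"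
    unfolding e mult_wreath using n_pos
    by (simp add: fun_eq_iff m_assoc restrict_def mod_simps add.assoc)
next
  fix x assume "x \<in> carrier W"
  then show "\<one>\<^bsub>W\<^esub> \<otimes>\<^bsub>W\<^esub> x = x"
    by (cases x) (auto simp: carrier_wreath one_wreath mult_wreath restrict_def fun_eq_iff PiE_iff extensional_def)
next
  fix g assume "g \<in> carrier W"
  then obtain x k where g: "g = (x, k)" and x: "x \<in> {..<n} \<rightarrow>\<^sub>E carrier XG" and k: "k < n"
    by (auto simp: carrier_wreath)
  \<comment> \<open>The outer mod covers k = 0, where n - k = n would not be an admissible exponent
    of the cycle.\<close>
  define l where "l = (n - k) mod n"
  have l: "l < n" "(l + k) mod n = 0" using n_pos k by (auto simp: l_def mod_simps)
  define y where "y = (\<lambda>i\<in>{..<n}. inv x ((i + l) mod n))"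
  have xi: "x i \<in> carrier XG" if "i < n" for i using x that by auto
  have "(y, l) \<in> carrier W" unfolding carrier_wreath y_def using xi l(1) n_pos by simp
  moreover have "(y, l) \<otimes>\<^bsub>W\<^esub> g = \<one>\<^bsub>W\<^esub>"
    unfolding g mult_wreath one_wreath y_def using xi l n_pos by (simp add: fun_eq_iff restrict_def)
  ultimately show "\<exists>h\<in>carrier W. h \<otimes>\<^bsub>W\<^esub> g = \<one>\<^bsub>W\<^esub>" by blast
qed

sublocale W: group W by (rule group_wreath)

lemma snd_pow_wreath: "g \<in> carrier W \<Longrightarrow> snd (g [^]\<^bsub>W\<^esub> (k::nat)) = (k * snd g) mod n"
  by (induction k) (simp_all add: one_wreath snd_mult_wreath mod_add_left_eq add.commute[of "snd g"])

lemma snd_mult_inv_wreath: "g \<in> carrier W \<Longrightarrow> (snd g + snd (inv\<^bsub>W\<^esub> g)) mod n = 0"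
  unfolding snd_mult_wreath[symmetric] by (simp add: one_wreath)

text \<open>The shifted index is the one that multiplies \<open>fst g i\<close> in the product of g
  with its inverse, so no subtraction modulo n has to appear.\<close>

lemma fst_inv_wreath:
  assumes "g \<in> carrier W" "i < n"
  shows "fst (inv\<^bsub>W\<^esub> g) ((i + snd g) mod n) = inv (fst g i)"
proof -
  have "fst (g \<otimes>\<^bsub>W\<^esub> inv\<^bsub>W\<^esub> g) i = \<one>" using assms by (simp add: one_wreath)
  then show ?thesis using assms n_pos
    by (metis fst_mult_wreath fst_wreath_closed W.inv_closed inv_equality inv_inv mod_less_divisor inv_comm)
qed

section \<open>Base groups and conjugation\<close>

lemma fst_conj_base:
  assumes g: "g \<in> carrier W" and h: "h \<in> carrier W" "snd h = 0" and i: "i < n"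
  shows "fst (g \<otimes>\<^bsub>W\<^esub> h \<otimes>\<^bsub>W\<^esub> inv\<^bsub>W\<^esub> g) i
    = fst g i \<otimes> fst h ((i + snd g) mod n) \<otimes> inv (fst g i)"
proof -
  have "snd (g \<otimes>\<^bsub>W\<^esub> h) = snd g" using snd_wreath_less[OF g] by (simp add: snd_mult_wreath h(2))
  then show ?thesis by (simp only: fst_mult_wreath[OF i] fst_inv_wreath[OF g i])
qed

lemma snd_conj_base:
  assumes "g \<in> carrier W" "h \<in> carrier W" "snd h = 0"
  shows "snd (g \<otimes>\<^bsub>W\<^esub> h \<otimes>\<^bsub>W\<^esub> inv\<^bsub>W\<^esub> g) = 0"
proof -
  have "snd (g \<otimes>\<^bsub>W\<^esub> h) = snd g" using snd_wreath_less[OF assms(1)] by (simp add: snd_mult_wreath assms(3))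
  then show ?thesis using snd_mult_inv_wreath[OF assms(1)] by (simp only: snd_mult_wreath)
qed

lemma mem_base_iff: "A \<subseteq> carrier XG \<Longrightarrow>
    g \<in> base A \<longleftrightarrow> g \<in> carrier W \<and> snd g = 0 \<and> (\<forall>i<n. fst g i \<in> A)"
proof (cases g)
  case (Pair x k)
  assume "A \<subseteq> carrier XG"
  then show ?thesis
    using n_pos unfolding base_def carrier_wreath Pair mem_Times_iff fst_conv snd_conv PiE_iff by blast
qed

lemma inv_base:
  assumes "g \<in> carrier W" "snd g = 0"
  shows "snd (inv\<^bsub>W\<^esub> g) = 0" "\<And>i. i < n \<Longrightarrow> fst (inv\<^bsub>W\<^esub> g) i = inv (fst g i)"
proof -
  show "snd (inv\<^bsub>W\<^esub> g) = 0" using snd_mult_inv_wreath[OF assms(1)]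
    by (metis W.inv_closed add_0 assms mod_less snd_wreath_less)
  show "fst (inv\<^bsub>W\<^esub> g) i = inv (fst g i)" if "i < n" for i
    using fst_inv_wreath[OF assms(1) that] assms that by simp
qed

lemma subgroup_base:
  assumes "subgroup A XG"
  shows "subgroup (base A) W"
proof -
  interpret A: subgroup A XG by fact
  note mem = mem_base_iff[OF A.subset]
  show ?thesis
  proof (rule W.subgroupI)
    show "base A \<subseteq> carrier W" by (auto simp: mem)
    have "\<one>\<^bsub>W\<^esub> \<in> base A" unfolding one_wreath base_def by simp
    then show "base A \<noteq> {}" by blast
    show "inv\<^bsub>W\<^esub> g \<in> base A" if "g \<in> base A" for g
      using that by (simp add: mem inv_base)
    show "g \<otimes>\<^bsub>W\<^esub> h \<in> base A" if "g \<in> base A" "h \<in> base A" for g h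
      using that by (simp add: mem fst_mult_wreath snd_mult_wreath)
  qed
qed

lemma normal_base:
  assumes "A \<lhd> XG"
  shows "base A \<lhd> W"
proof -
  interpret A: normal A XG by fact
  have "g \<otimes>\<^bsub>W\<^esub> h \<otimes>\<^bsub>W\<^esub> inv\<^bsub>W\<^esub> g \<in> base A" if "g \<in> carrier W" "h \<in> base A" for g h
    using that n_pos unfolding mem_base_iff[OF A.subset]
    by (auto simp: fst_conj_base snd_conj_base A.inv_op_closed2 fst_wreath_closed)
  then show ?thesis unfolding W.normal_inv_iff
    using subgroup_base[OF A.subgroup_axioms] by blast
qed

section \<open>Coordinate subgroups and their direct product\<close>

lemma single_closed: "a \<in> carrier XG \<Longrightarrow> single i a \<in> carrier W"
  using n_pos unfolding single_def carrier_wreath by simp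

lemma fst_single: "j < n \<Longrightarrow> fst (single i a) j = (if j = i then a else \<one>)"
  by (simp add: single_def)

lemma snd_single [simp]: "snd (single i a) = 0"
  by (simp add: single_def)

lemma single_mem_base: "subgroup A XG \<Longrightarrow> a \<in> A \<Longrightarrow> single i a \<in> base A"
  by (simp add: mem_base_iff subgroup.subset single_closed subgroup.mem_carrier fst_single subgroup.one_closed)

lemma single_mult:
  assumes "a \<in> carrier XG" "a' \<in> carrier XG"
  shows "single i (a \<otimes> a') = single i a \<otimes>\<^bsub>W\<^esub> single i a'"
  using assms by (intro wreath_eqI) (simp_all add: single_closed fst_mult_wreath snd_mult_wreath fst_single)

lemma inj_single: "i < n \<Longrightarrow> inj (single i)"
  by (rule inj_on_inverseI[of _ "\<lambda>g. fst g i"]) (simp add: fst_single)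

lemma single_one: "single i \<one> = \<one>\<^bsub>W\<^esub>"
  by (simp add: single_def one_wreath restrict_def)

lemma group_hom_single: "group_hom XG W (single i)"
  by unfold_locales (simp add: hom_def single_closed single_mult)

lemma single_iso:
  assumes "subgroup A XG" "i < n"
  shows "single i \<in> iso (XG\<lparr>carrier := A\<rparr>) (W\<lparr>carrier := single i ` A\<rparr>)"
  using assms inj_single[OF assms(2)] 
  by (auto simp: iso_def hom_def bij_betw_def single_mult subgroup.mem_carrier intro: inj_on_subset)

lemma subgroup_single: "subgroup A XG \<Longrightarrow> subgroup (single i ` A) W"
  by (rule group_hom.subgroup_img_is_subgroup[OF group_hom_single])

lemma conj_single:
  assumes "g \<in> carrier W" "a \<in> carrier XG" "i < n"
  shows "g \<otimes>\<^bsub>W\<^esub> single ((i + snd g) mod n) a \<otimes>\<^bsub>W\<^esub> inv\<^bsub>W\<^esub> g = single i (fst g i \<otimes> a \<otimes> inv (fst g i))"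
proof (rule wreath_eqI)
  fix j assume j: "j < n"
  \<comment> \<open>Rotation is injective, so the conjugate is nontrivial in at most one
    coordinate.\<close>
  have "(j + snd g) mod n = (i + snd g) mod n \<longleftrightarrow> j = i"
    using add_mod_add_eq_zero_imp_mod_eq[OF j snd_mult_inv_wreath[OF assms(1)]]
      add_mod_add_eq_zero_imp_mod_eq[OF assms(3) snd_mult_inv_wreath[OF assms(1)]] by metis
  then show "fst (g \<otimes>\<^bsub>W\<^esub> single ((i + snd g) mod n) a \<otimes>\<^bsub>W\<^esub> inv\<^bsub>W\<^esub> g) j
    = fst (single i (fst g i \<otimes> a \<otimes> inv (fst g i))) j"
    using assms j n_pos by (simp add: fst_conj_base single_closed fst_single fst_wreath_closed)
qed (use assms in \<open>simp_all add: single_closed fst_wreath_closed snd_conj_base\<close>)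

text \<open>The list is arbitrary to make the induction work; \<open>lprod\<close> is the instance
  \<open>[0..<n]\<close>.\<close>

lemma foldr_single:
  assumes "distinct xs" "set xs \<subseteq> {..<n}" "\<And>i. i < n \<Longrightarrow> a i \<in> carrier XG"
  shows "foldr (\<lambda>i acc. single i (a i) \<otimes>\<^bsub>W\<^esub> acc) xs \<one>\<^bsub>W\<^esub>
    = ((\<lambda>j\<in>{..<n}. if j \<in> set xs then a j else \<one>), 0)"
  using assms
proof (induction xs)
  case Nil
  then show ?case by (simp add: one_wreath restrict_def)
next
  case (Cons i xs)
  then show ?case
    by (auto simp: single_def mult_wreath fun_eq_iff restrict_def)
qed

lemma lprod_single:
  assumes "\<And>i. i < n \<Longrightarrow> a i \<in> carrier XG" "\<And>i. i < n \<Longrightarrow> t i = single i (a i)"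
  shows "lprod W t n = ((\<lambda>j\<in>{..<n}. a j), 0)"
proof -
  have "lprod W t n = foldr (\<lambda>i acc. single i (a i) \<otimes>\<^bsub>W\<^esub> acc) [0..<n] \<one>\<^bsub>W\<^esub>"
    unfolding lprod_def using assms(2) by (intro foldr_cong) auto
  also have "\<dots> = ((\<lambda>j\<in>{..<n}. a j), 0)"
    using assms(1) by (subst foldr_single) (auto simp: restrict_def fun_eq_iff)
  finally show ?thesis .
qed

lemma lprod_PiE_single:
  assumes A: "A \<subseteq> carrier XG" and t: "t \<in> (\<Pi>\<^sub>E i\<in>{..<n}. single i ` A)"
  shows "lprod W t n = ((\<lambda>j\<in>{..<n}. fst (t j) j), 0)"
proof (rule lprod_single)
  fix i assume i: "i < n"
  then obtain a where "a \<in> A" "t i = single i a" using t by auto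
  then show "fst (t i) i \<in> carrier XG" "t i = single i (fst (t i) i)"
    using i A by (auto simp: fst_single)
qed

lemma lprod_single_base:
  assumes "A \<subseteq> carrier XG" "m \<in> base A"
  shows "(\<lambda>i\<in>{..<n}. single i (fst m i)) \<in> (\<Pi>\<^sub>E i\<in>{..<n}. single i ` A)"
    and "lprod W (\<lambda>i\<in>{..<n}. single i (fst m i)) n = m"
proof -
  show "(\<lambda>i\<in>{..<n}. single i (fst m i)) \<in> (\<Pi>\<^sub>E i\<in>{..<n}. single i ` A)"
    using assms by (auto simp: mem_base_iff)
  have "lprod W (\<lambda>i\<in>{..<n}. single i (fst m i)) n = ((\<lambda>j\<in>{..<n}. fst m j), 0)"
    using assms by (intro lprod_single) (auto simp: mem_base_iff)
  also have "\<dots> = m" using assms by (auto simp: base_def restrict_def fun_eq_iff PiE_iff extensional_def)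
  finally show "lprod W (\<lambda>i\<in>{..<n}. single i (fst m i)) n = m" .
qed

lemma bij_betw_lprod:
  assumes A: "A \<subseteq> carrier XG"
  shows "bij_betw (\<lambda>t. lprod W t n) (\<Pi>\<^sub>E i\<in>{..<n}. single i ` A) (base A)"
proof (rule bij_betw_byWitness[where f' = "\<lambda>m. \<lambda>i\<in>{..<n}. single i (fst m i)"])
  show "\<forall>t\<in>\<Pi>\<^sub>E i\<in>{..<n}. single i ` A. (\<lambda>i\<in>{..<n}. single i (fst (lprod W t n) i)) = t"
  proof
    fix t assume t: "t \<in> (\<Pi>\<^sub>E i\<in>{..<n}. single i ` A)"
    show "(\<lambda>i\<in>{..<n}. single i (fst (lprod W t n) i)) = t"
    proof (rule PiE_ext[OF _ t])
      show "(\<lambda>i\<in>{..<n}. single i (fst (lprod W t n) i)) \<in> (\<Pi>\<^sub>E i\<in>{..<n}. single i ` A)"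
        using t by (auto simp: lprod_PiE_single[OF A t] fst_single PiE_iff)
           (metis fst_single imageE imageI lessThan_iff)
      fix i assume "i \<in> {..<n}"
      moreover then obtain a where "t i = single i a" using t by auto
      ultimately show "(\<lambda>i\<in>{..<n}. single i (fst (lprod W t n) i)) i = t i"
        by (simp add: lprod_PiE_single[OF A t] fst_single)
    qed
  qed
  show "(\<lambda>t. lprod W t n) ` (\<Pi>\<^sub>E i\<in>{..<n}. single i ` A) \<subseteq> base A"
  proof (rule image_subsetI)
    fix t assume t: "t \<in> (\<Pi>\<^sub>E i\<in>{..<n}. single i ` A)"
    have "fst (t i) i \<in> A" if i: "i < n" for i
    proof -
      obtain a where "a \<in> A" "t i = single i a" using t i by auto
      then show ?thesis using i by (simp add: fst_single)
    qed
    then show "lprod W t n \<in> base A" by (auto simp: lprod_PiE_single[OF A t] base_def)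
  qed
  show "\<forall>m\<in>base A. lprod W (\<lambda>i\<in>{..<n}. single i (fst m i)) n = m"
    using lprod_single_base(2)[OF A] by (intro ballI)
  show "(\<lambda>m. \<lambda>i\<in>{..<n}. single i (fst m i)) ` base A \<subseteq> (\<Pi>\<^sub>E i\<in>{..<n}. single i ` A)"
    using lprod_single_base(1)[OF A] by (rule image_subsetI)
qed

text \<open>The definition of PA type reads projections through the inverse of the product map. This
  turns them into plain coordinates, re-embedded by \<open>single i\<close>, and every later
  statement about projections goes through it.\<close>

lemma inv_into_lprod:
  assumes A: "A \<subseteq> carrier XG" and m: "m \<in> base A" and i: "i < n"
  shows "inv_into (\<Pi>\<^sub>E j\<in>{..<n}. single j ` A) (\<lambda>t. lprod W t n) m i = single i (fst m i)"
proof -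
  have "inv_into (\<Pi>\<^sub>E j\<in>{..<n}. single j ` A) (\<lambda>t. lprod W t n) m = (\<lambda>i\<in>{..<n}. single i (fst m i))"
    by (rule inv_into_f_eq[OF bij_betw_imp_inj_on[OF bij_betw_lprod[OF A]]])
       (use lprod_single_base[OF A m] in auto)
  then show ?thesis using i by simp
qed

lemma lprod_iso:
  assumes A: "subgroup A XG"
  shows "(\<lambda>t. lprod W t n)
    \<in> iso (product_group {..<n} (\<lambda>i. W\<lparr>carrier := single i ` A\<rparr>)) (W\<lparr>carrier := base A\<rparr>)"
proof -
  note Ac = subgroup.subset[OF A]
  let ?P = "product_group {..<n} (\<lambda>i. W\<lparr>carrier := single i ` A\<rparr>)"
  have bij: "bij_betw (\<lambda>t. lprod W t n) (carrier ?P) (base A)"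
    using bij_betw_lprod[OF Ac] by simp
  moreover have "lprod W (t \<otimes>\<^bsub>?P\<^esub> t') n = lprod W t n \<otimes>\<^bsub>W\<^esub> lprod W t' n"
    if t: "t \<in> carrier ?P" "t' \<in> carrier ?P" for t t'
  proof -
    have "group ?P"
      by (intro product_group W.subgroup_imp_group subgroup_single A)
    then have "t \<otimes>\<^bsub>?P\<^esub> t' \<in> carrier ?P" using t by (simp add: group.is_monoid monoid.m_closed del: mult_product_group carrier_product_group)
    then have m: "t \<otimes>\<^bsub>?P\<^esub> t' \<in> (\<Pi>\<^sub>E i\<in>{..<n}. single i ` A)" by simp
    have t': "t \<in> (\<Pi>\<^sub>E i\<in>{..<n}. single i ` A)" "t' \<in> (\<Pi>\<^sub>E i\<in>{..<n}. single i ` A)" using t by simp_all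
    have "snd (t i) = 0" if "i < n" for i
    proof -
      have "t i \<in> single i ` A" using t'(1) that by auto
      then show ?thesis by auto
    qed
    then show ?thesis
      unfolding lprod_PiE_single[OF Ac m] lprod_PiE_single[OF Ac t'(1)] lprod_PiE_single[OF Ac t'(2)]
      by (auto simp: mult_wreath fst_mult_wreath fun_eq_iff restrict_def)
  qed
  ultimately show ?thesis using bij_betwE[OF bij] by (auto simp: iso_def hom_def)
qed

section \<open>Normal subgroups and the criterion for PA type\<close>

lemma lprod_closed:
  assumes "subgroup N W" "\<And>i. i < k \<Longrightarrow> t i \<in> N"
  shows "lprod W t k \<in> N"
proof -
  have "foldr (\<lambda>i acc. t i \<otimes>\<^bsub>W\<^esub> acc) xs \<one>\<^bsub>W\<^esub> \<in> N" if "set xs \<subseteq> {..<k}" for xs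
    using that by (induction xs) (auto simp: assms subgroup.one_closed subgroup.m_closed)
  then show ?thesis by (simp add: lprod_def atLeast0LessThan)
qed

text \<open>If g rotates nontrivially, conjugation by g moves the support of
  \<open>single 0 a\<close> away from coordinate 0, so the commutator sees only the inverse of a
  there. This converts an element outside the base group into a base element that is visibly
  nontrivial when a is.\<close>

lemma commutator_single:
  assumes g: "g \<in> carrier W" "snd g \<noteq> 0" and a: "a \<in> carrier XG"
  defines "m \<equiv> g \<otimes>\<^bsub>W\<^esub> single 0 a \<otimes>\<^bsub>W\<^esub> inv\<^bsub>W\<^esub> g \<otimes>\<^bsub>W\<^esub> inv\<^bsub>W\<^esub> (single 0 a)"
  shows "snd m = 0" "fst m 0 = inv a"
proof -
  note s = single_closed[OF a, of 0]
  let ?u = "g \<otimes>\<^bsub>W\<^esub> single 0 a \<otimes>\<^bsub>W\<^esub> inv\<^bsub>W\<^esub> g"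
  have u: "snd ?u = 0" by (rule snd_conj_base) (simp_all add: g s)
  have "snd m = (snd ?u + snd (inv\<^bsub>W\<^esub> single 0 a)) mod n" unfolding m_def by (rule snd_mult_wreath)
  then show "snd m = 0" by (simp only: u inv_base[OF s snd_single]) simp
  have k: "(0 + snd g) mod n = snd g" using snd_wreath_less[OF g(1)] by simp
  have "fst ?u 0 = \<one>"
    using g fst_wreath_closed[OF g(1) n_pos] snd_wreath_less[OF g(1)]
    by (simp only: fst_conj_base[OF g(1) s snd_single n_pos] k fst_single) simp
  then show "fst m 0 = inv a"
    using a n_pos by (simp add: m_def fst_mult_wreath u inv_base[OF s snd_single] fst_single)
qed

lemma diagonal_pow:
  assumes "a \<in> carrier XG"
  shows "((\<lambda>i\<in>{..<n}. a), 0) [^]\<^bsub>W\<^esub> (k::nat) = ((\<lambda>i\<in>{..<n}. a [^] k), 0)"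
  by (induction k) (auto simp: one_wreath mult_wreath fun_eq_iff)

text \<open>This is A wr \<langle>\<tau>\<rangle> with the rotation part left free, so that a
  rotating generator such as \<theta> can be placed in it.\<close>

lemma subgroup_coordinates:
  assumes "subgroup A XG"
  shows "subgroup {g \<in> carrier W. \<forall>i<n. fst g i \<in> A} W"
proof -
  interpret A: subgroup A XG by fact
  show ?thesis
  proof (rule W.subgroupI)
    have "\<one>\<^bsub>W\<^esub> \<in> {g \<in> carrier W. \<forall>i<n. fst g i \<in> A}" using W.one_closed by (simp add: one_wreath)
    then show "{g \<in> carrier W. \<forall>i<n. fst g i \<in> A} \<noteq> {}" by blast
  next
    fix g assume g: "g \<in> {g \<in> carrier W. \<forall>i<n. fst g i \<in> A}"
    have "fst (inv\<^bsub>W\<^esub> g) i \<in> A" if i: "i < n" for i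
    proof -
      let ?j = "(i + snd (inv\<^bsub>W\<^esub> g)) mod n"
      have "fst g ?j = inv (fst (inv\<^bsub>W\<^esub> g) i)"
        using fst_inv_wreath[of "inv\<^bsub>W\<^esub> g" i] g i by simp
      moreover have "fst g ?j \<in> A" using g n_pos by simp
      moreover have "fst (inv\<^bsub>W\<^esub> g) i \<in> carrier XG" using g i by (simp add: fst_wreath_closed)
      ultimately show ?thesis using A.m_inv_closed by (metis inv_inv)
    qed
    then show "inv\<^bsub>W\<^esub> g \<in> {g \<in> carrier W. \<forall>i<n. fst g i \<in> A}" using g by simp
  next
    fix g h assume "g \<in> {g \<in> carrier W. \<forall>i<n. fst g i \<in> A}" "h \<in> {g \<in> carrier W. \<forall>i<n. fst g i \<in> A}"
    then show "g \<otimes>\<^bsub>W\<^esub> h \<in> {g \<in> carrier W. \<forall>i<n. fst g i \<in> A}"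
      using n_pos by (simp add: fst_mult_wreath)
  qed blast
qed

text \<open>Two commutators isolate a coordinate: one removes the rotation, the next, with an
  element supported on coordinate i, removes all other coordinates. What is left is a nontrivial
  element of T in coordinate i; simplicity fills that coordinate, and rotations in S carry it to the
  others.\<close>

lemma base_subset_normal:
  assumes T: "T \<lhd> XG" and simple: "simple_group (XG\<lparr>carrier := T\<rparr>)"
    and cent: "centralizer XG T = {\<one>}"
    and S: "subgroup S W" "base T \<subseteq> S"
    and rot: "\<And>i j. i < n \<Longrightarrow> j < n \<Longrightarrow> \<exists>g\<in>S. (j + snd g) mod n = i"
    and N: "N \<lhd> (W\<lparr>carrier := S\<rparr>)" "N \<noteq> {\<one>\<^bsub>W\<^esub>}"
  shows "base T \<subseteq> N"
proof -
  interpret T: normal T XG by fact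
  interpret S: subgroup S W by fact
  interpret TG: simple_group "XG\<lparr>carrier := T\<rparr>" by fact
  have NS: "subgroup N (W\<lparr>carrier := S\<rparr>)" using N(1) by (rule normal_imp_subgroup)
  interpret N: subgroup N W using W.incl_subgroup[OF S(1) NS] .
  have NsubS: "N \<subseteq> S" using subgroup.subset[OF NS] by simp
  have sT: "single i t \<in> S" if "t \<in> T" for i t
    using single_mem_base[OF T.subgroup_axioms that] S(2) by blast
  have comm: "g \<otimes>\<^bsub>W\<^esub> s \<otimes>\<^bsub>W\<^esub> inv\<^bsub>W\<^esub> g \<otimes>\<^bsub>W\<^esub> inv\<^bsub>W\<^esub> s \<in> N" if "g \<in> N" "s \<in> S" for g s
  proof -
    have "g \<otimes>\<^bsub>W\<^esub> (s \<otimes>\<^bsub>W\<^esub> inv\<^bsub>W\<^esub> g \<otimes>\<^bsub>W\<^esub> inv\<^bsub>W\<^esub> s) \<in> N"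
      using that W.normal_conj_closed[OF S(1) N(1), of s "inv\<^bsub>W\<^esub> g"] by simp
    then show ?thesis using that by (simp add: W.m_assoc)
  qed
  obtain g where g: "g \<in> N" "g \<noteq> \<one>\<^bsub>W\<^esub>" using N(2) N.one_closed by blast
  \<comment> \<open>If g already has no rotation part, some coordinate of g is nontrivial. Otherwise
    the commutator of g with \<open>single 0 t\<close> is in N and has the inverse of t in
    coordinate 0.\<close>
  have "\<exists>m\<in>N. \<exists>i<n. snd m = 0 \<and> fst m i \<noteq> \<one>"
  proof (cases "snd g = 0")
    case True
    have "\<exists>i<n. fst g i \<noteq> \<one>"
    proof (rule ccontr)
      assume "\<not> (\<exists>i<n. fst g i \<noteq> \<one>)"
      then have "g = \<one>\<^bsub>W\<^esub>" using g True by (intro wreath_eqI) (auto simp: one_wreath[THEN arg_cong[of _ _ fst]] one_wreath[THEN arg_cong[of _ _ snd]])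
      then show False using g by simp
    qed
    then show ?thesis using g True by blast
  next
    case False
    obtain t where t: "t \<in> T" "t \<noteq> \<one>" using TG.simple_not_triv T.one_closed by auto
    show ?thesis
      using comm[OF g(1) sT[OF t(1), of 0]] commutator_single[OF N.mem_carrier[OF g(1)] False T.mem_carrier[OF t(1)]]
        t n_pos inv_eq_1_iff[OF T.mem_carrier[OF t(1)]] by metis
  qed
  then obtain m i where m: "m \<in> N" "snd m = 0" "i < n" "fst m i \<noteq> \<one>" by blast
  define a where "a = fst m i"
  have a: "a \<in> carrier XG" using m fst_wreath_closed N.mem_carrier by (simp add: a_def)
  \<comment> \<open>The coordinate a is only known to lie in X, so noncommutation with some t in T
    comes from the trivial centraliser of T in X. Normality of T then puts the commutator u into
    T.\<close>
  have "a \<notin> centralizer XG T" using cent m by (simp add: a_def)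
  then obtain t where t: "t \<in> T" "a \<otimes> t \<noteq> t \<otimes> a" using a by (auto simp: centralizer_def)
  note tc = T.mem_carrier[OF t(1)]
  define u where "u = a \<otimes> t \<otimes> inv a \<otimes> inv t"
  have uT: "u \<in> T" using t a T.inv_op_closed2[OF a t(1)] by (simp add: u_def)
  have u1: "u \<noteq> \<one>"
  proof
    assume "u = \<one>"
    then have "a \<otimes> t \<otimes> inv a = t" using a tc by (simp add: u_def inv_solve_right')
    then have "a \<otimes> t = t \<otimes> a" using a tc by (simp add: inv_solve_right')
    then show False using t by simp
  qed
  have "m \<otimes>\<^bsub>W\<^esub> single i t \<otimes>\<^bsub>W\<^esub> inv\<^bsub>W\<^esub> m = single i (a \<otimes> t \<otimes> inv a)"
    using conj_single[OF N.mem_carrier[OF m(1)] tc m(3)] m by (simp add: a_def)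
  then have "single i (a \<otimes> t \<otimes> inv a) \<otimes>\<^bsub>W\<^esub> inv\<^bsub>W\<^esub> (single i t) \<in> N"
    using comm[OF m(1) sT[OF t(1), of i]] by simp
  then have uN: "single i u \<in> N"
    using a tc group_hom.hom_inv[OF group_hom_single tc, of i] by (simp add: u_def single_mult)
  \<comment> \<open>The trace of N on coordinate i, pulled back to T. It is normalised by T because
    the embedded copy of T lies in S, and it contains u.\<close>
  define D where "D = {x \<in> T. single i x \<in> N}"
  have "D \<lhd> XG\<lparr>carrier := T\<rparr>" unfolding TG.normal_inv_iff
  proof
    show "subgroup D (XG\<lparr>carrier := T\<rparr>)"
    proof (rule TG.subgroupI)
      show "D \<noteq> {}" using uT uN by (auto simp: D_def)
      show "inv\<^bsub>XG\<lparr>carrier := T\<rparr>\<^esub> x \<in> D" if "x \<in> D" for x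
        using that group_hom.hom_inv[OF group_hom_single, of x i] N.m_inv_closed
        by (auto simp: D_def m_inv_consistent[OF T.subgroup_axioms])
      show "x \<otimes>\<^bsub>XG\<lparr>carrier := T\<rparr>\<^esub> y \<in> D" if "x \<in> D" "y \<in> D" for x y
        using that by (auto simp: D_def single_mult)
    qed (auto simp: D_def)
    show "\<forall>x\<in>carrier (XG\<lparr>carrier := T\<rparr>). \<forall>h\<in>D.
      x \<otimes>\<^bsub>XG\<lparr>carrier := T\<rparr>\<^esub> h \<otimes>\<^bsub>XG\<lparr>carrier := T\<rparr>\<^esub> inv\<^bsub>XG\<lparr>carrier := T\<rparr>\<^esub> x \<in> D"
    proof (intro ballI)
      fix x h assume "x \<in> carrier (XG\<lparr>carrier := T\<rparr>)" and h: "h \<in> D"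
      then have x: "x \<in> T" by simp
      have hT: "h \<in> T" "single i h \<in> N" using h by (auto simp: D_def)
      have "single i (x \<otimes> h \<otimes> inv x) = single i x \<otimes>\<^bsub>W\<^esub> single i h \<otimes>\<^bsub>W\<^esub> inv\<^bsub>W\<^esub> single i x"
        using x hT group_hom.hom_inv[OF group_hom_single, of x i] by (simp add: single_mult)
      also have "\<dots> \<in> N" using W.normal_conj_closed[OF S(1) N(1) sT[OF x] hT(2)] .
      finally show "x \<otimes>\<^bsub>XG\<lparr>carrier := T\<rparr>\<^esub> h \<otimes>\<^bsub>XG\<lparr>carrier := T\<rparr>\<^esub> inv\<^bsub>XG\<lparr>carrier := T\<rparr>\<^esub> x \<in> D"
        using x hT by (simp add: D_def m_inv_consistent[OF T.subgroup_axioms])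
    qed
  qed
  then have "D = T" using TG.no_real_normal_subgroup[of D] uT uN u1 by (auto simp: D_def)
  then have iN: "single i x \<in> N" if "x \<in> T" for x using that by (auto simp: D_def)
  have jN: "single j x \<in> N" if j: "j < n" and x: "x \<in> T" for j x
  proof -
    obtain g where g: "g \<in> S" "(j + snd g) mod n = i" using rot[OF m(3) j] by blast
    define d where "d = fst g j"
    have d: "d \<in> carrier XG" using g j by (simp add: d_def fst_wreath_closed)
    \<comment> \<open>Conjugation by g moves coordinate i to j but also twists the entry by d; x is
      untwisted beforehand so that exactly x arrives. The untwisted element is in T because T is
      normal in X.\<close>
    have x': "inv d \<otimes> x \<otimes> d \<in> T" using T.inv_op_closed1[OF d x] .
    have "g \<otimes>\<^bsub>W\<^esub> single i (inv d \<otimes> x \<otimes> d) \<otimes>\<^bsub>W\<^esub> inv\<^bsub>W\<^esub> g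
        = single j (d \<otimes> (inv d \<otimes> x \<otimes> d) \<otimes> inv d)"
      using conj_single[OF S.mem_carrier[OF g(1)] T.mem_carrier[OF x'] j] g by (simp add: d_def)
    also have "d \<otimes> (inv d \<otimes> x \<otimes> d) \<otimes> inv d = x"
      using d x by (metis T.mem_carrier inv_closed m_assoc m_closed r_inv l_one r_one)
    finally show ?thesis using W.normal_conj_closed[OF S(1) N(1) g(1) iN[OF x']] by simp
  qed
  show ?thesis
  proof
    fix m assume m: "m \<in> base T"
    have "lprod W (\<lambda>i\<in>{..<n}. single i (fst m i)) n \<in> N"
      using m jN by (intro lprod_closed N.subgroup_axioms) (simp add: mem_base_iff[OF T.subset])
    then show "m \<in> N" using lprod_single_base(2)[OF T.subset m] by simp
  qed
qed

text \<open>This separates the group theory from the affine data: S and H stand for G and its point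
  stabiliser, A for \<open>R \<inter> T\<close>. Rotations in S make \<open>base T\<close> minimal
  normal, the factorisation of S makes it transitive, properness of A makes H core-free, and
  \<open>ker\<close> supplies the non-diagonal condition.\<close>

theorem quasiprimitive_nondiagonal_PA_wreath:
  assumes T: "T \<lhd> XG" and simple: "nonabelian_simple (XG\<lparr>carrier := T\<rparr>)"
    and cent: "centralizer XG T = {\<one>}" and n2: "n \<ge> 2"
    and S: "subgroup S W" "base T \<subseteq> S"
    and rot: "\<And>i j. i < n \<Longrightarrow> j < n \<Longrightarrow> \<exists>g\<in>S. (j + snd g) mod n = i"
    and H: "subgroup H W" "H \<subseteq> S" "S \<subseteq> base T <#>\<^bsub>W\<^esub> H"
    and A: "subgroup A XG" "A \<subseteq> T" "A \<noteq> T" "A \<noteq> {\<one>}"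
    and sub: "base T \<inter> H \<subseteq> base A"
    and proj: "\<And>i. i < n \<Longrightarrow> (\<lambda>x. fst x i) ` (base T \<inter> H) = A"
    and ker: "\<exists>i<n. \<exists>x\<in>base T \<inter> H. x \<noteq> \<one>\<^bsub>W\<^esub> \<and> fst x i = \<one>"
  shows "quasiprimitive_nondiagonal_PA (W\<lparr>carrier := S\<rparr>) (rcosets\<^bsub>W\<lparr>carrier := S\<rparr>\<^esub> H)
    (\<lambda>C g. C #>\<^bsub>W\<^esub> g)"
proof -
  interpret T: normal T XG by fact
  interpret S: subgroup S W by fact
  interpret H: subgroup H W by fact
  let ?G = "W\<lparr>carrier := S\<rparr>"
  interpret G: group ?G by (rule W.subgroup_imp_group[OF S(1)])
  have sg: "simple_group (XG\<lparr>carrier := T\<rparr>)" and nc: "\<not> comm_group (XG\<lparr>carrier := T\<rparr>)"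
    using simple by (auto simp: nonabelian_simple_def)
  have HG: "subgroup H ?G" using W.subgroup_incl[OF H(1) S(1) H(2)] .
  have one: "\<one>\<^bsub>?G\<^esub> = \<one>\<^bsub>W\<^esub>" by simp
  have rc: "r_coset ?G = r_coset W" by (simp add: r_coset_def fun_eq_iff)
  have min: "base T \<subseteq> N" if "N \<lhd> ?G" "N \<noteq> {\<one>\<^bsub>W\<^esub>}" for N
    using base_subset_normal[OF T sg cent S rot that] .
  \<comment> \<open>If H contained \<open>base T\<close>, the projection of their intersection would
    be all of T, whereas \<open>proj\<close> says it is A. Together with \<open>min\<close> this
    leaves no nontrivial normal subgroup inside H.\<close>
  have not_le: "\<not> base T \<subseteq> H"
  proof
    assume "base T \<subseteq> H"
    then have eq: "base T \<inter> H = base T" by blast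
    have "x \<in> A" if "x \<in> T" for x
    proof -
      have "single 0 x \<in> base T \<inter> H" unfolding eq using single_mem_base[OF T.subgroup_axioms that] .
      then have "fst (single 0 x) 0 \<in> A" using proj[OF n_pos] by blast
      then show ?thesis using n_pos by (simp add: fst_single)
    qed
    then show False using A by blast
  qed
  have trans: "transitive_perm_group ?G (rcosets\<^bsub>?G\<^esub> H) (\<lambda>C g. C #>\<^bsub>W\<^esub> g)"
    using G.transitive_perm_group_rcosets[OF HG] min not_le unfolding rc one by blast
  have Tnorm: "base T \<lhd> ?G"
    using W.normal_restrict_supergroup[OF S(1) normal_base[OF T] S(2)] .
  obtain t where t: "t \<in> T" "t \<noteq> \<one>" using simple_group.simple_not_triv[OF sg] T.one_closed by auto
  have "base T \<noteq> {\<one>\<^bsub>W\<^esub>}"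
  proof
    assume "base T = {\<one>\<^bsub>W\<^esub>}"
    then have "fst (single 0 t) 0 = fst \<one>\<^bsub>W\<^esub> 0" using single_mem_base[OF T.subgroup_axioms t(1), of 0] by simp
    then show False using t n_pos by (simp add: fst_single one_wreath)
  qed
  then have minT: "minimal_normal ?G (base T)"
    unfolding minimal_normal_def one using Tnorm min by blast
  have uniq: "N = base T" if "minimal_normal ?G N" for N
    using that min[of N] Tnorm \<open>base T \<noteq> {\<one>\<^bsub>W\<^esub>}\<close> unfolding minimal_normal_def one by blast
  have tr: "\<exists>g\<in>base T. C #>\<^bsub>W\<^esub> g = C'" if C: "C \<in> rcosets\<^bsub>?G\<^esub> H" "C' \<in> rcosets\<^bsub>?G\<^esub> H" for C C'
  proof -
    obtain x where x: "x \<in> S" "C = H #>\<^bsub>W\<^esub> x" using C(1) by (auto simp: RCOSETS_def rc)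
    obtain y where y: "y \<in> S" "C' = H #>\<^bsub>W\<^esub> y" using C(2) by (auto simp: RCOSETS_def rc)
    \<comment> \<open>For right cosets of H the base factor must stand on the right, so the
      factorisation of S is first turned around using normality of \<open>base T\<close> in
      W.\<close>
    have rep: "\<exists>t\<in>base T. H #>\<^bsub>W\<^esub> x = H #>\<^bsub>W\<^esub> t" if xS: "x \<in> S" for x
    proof -
      have "x \<in> H <#>\<^bsub>W\<^esub> base T"
        using H(3) xS W.commut_normal[OF H(1) normal_base[OF T]] by blast
      then obtain h t where "h \<in> H" "t \<in> base T" "x = h \<otimes>\<^bsub>W\<^esub> t" by (auto simp: set_mult_def)
      moreover have "t \<in> carrier W" using \<open>t \<in> base T\<close> S(2) S.subset by blast
      ultimately have "H #>\<^bsub>W\<^esub> x = H #>\<^bsub>W\<^esub> t"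
        using W.coset_mult_assoc[OF H.subset, of h t, symmetric] W.coset_join2[OF _ H(1), of h] by simp
      then show ?thesis using \<open>t \<in> base T\<close> by blast
    qed
    obtain x' where x': "x' \<in> base T" "C = H #>\<^bsub>W\<^esub> x'" using rep[OF x(1)] x(2) by blast
    obtain y' where y': "y' \<in> base T" "C' = H #>\<^bsub>W\<^esub> y'" using rep[OF y(1)] y(2) by blast
    interpret B: subgroup "base T" W using subgroup_base[OF T.subgroup_axioms] .
    have "C #>\<^bsub>W\<^esub> (inv\<^bsub>W\<^esub> x' \<otimes>\<^bsub>W\<^esub> y') = C'"
      using x' y' by (simp add: W.coset_mult_assoc[OF H.subset] flip: W.m_assoc)
    then show ?thesis using x' y' by blast
  qed
  have stab: "{m \<in> base T. H #>\<^bsub>W\<^esub> m = H} = base T \<inter> H"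
  proof -
    have "H #>\<^bsub>W\<^esub> m = H \<longleftrightarrow> m \<in> H" if "m \<in> base T" for m
    proof -
      have "m \<in> carrier W" using that S(2) S.subset by blast
      then show ?thesis using W.coset_join1[OF _ _ H(1)] W.coset_join2[OF _ H(1)] by blast
    qed
    then show ?thesis by blast
  qed
  have Ac: "A \<subseteq> carrier XG" using subgroup.subset[OF A(1)] .
  have sub_single: "subgroup (single i ` A') ?G" if "subgroup A' XG" "A' \<subseteq> T" for A' i
  proof (rule W.subgroup_incl[OF subgroup_single[OF that(1)] S(1)])
    show "single i ` A' \<subseteq> S"
      using single_mem_base[OF T.subgroup_axioms] that(2) S(2) by blast
  qed
  have iso_single: "?G\<lparr>carrier := single i ` A'\<rparr> \<cong> ?G\<lparr>carrier := single j ` A'\<rparr>"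
    if "subgroup A' XG" "i < n" "j < n" for A' i j
  proof -
    have "XG\<lparr>carrier := A'\<rparr> \<cong> W\<lparr>carrier := single i ` A'\<rparr>" "XG\<lparr>carrier := A'\<rparr> \<cong> W\<lparr>carrier := single j ` A'\<rparr>"
      using single_iso[OF that(1)] that unfolding is_iso_def by blast+
    then show ?thesis
      using group.iso_sym[OF subgroup_imp_group[OF that(1)]] iso_trans by fastforce
  qed
  have simple_single: "nonabelian_simple (?G\<lparr>carrier := single i ` T\<rparr>)" if i: "i < n" for i
  proof -
    note iso = single_iso[OF T.subgroup_axioms i]
    have g: "group (W\<lparr>carrier := single i ` T\<rparr>)"
      using W.subgroup_imp_group[OF subgroup_single[OF T.subgroup_axioms]] .
    have "simple_group (W\<lparr>carrier := single i ` T\<rparr>)"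
      using simple_group.iso_simple[OF sg g iso] .
    moreover have "\<not> comm_group (W\<lparr>carrier := single i ` T\<rparr>)"
    proof
      assume c: "comm_group (W\<lparr>carrier := single i ` T\<rparr>)"
      have "W\<lparr>carrier := single i ` T\<rparr> \<cong> XG\<lparr>carrier := T\<rparr>"
        using group.iso_sym[OF subgroup_imp_group[OF T.subgroup_axioms]] iso by (auto simp: is_iso_def)
      then show False using comm_group.iso_imp_comm_group[OF c] group.is_monoid[OF subgroup_imp_group[OF T.subgroup_axioms]] nc by blast
    qed
    ultimately show ?thesis by (simp add: nonabelian_simple_def)
  qed
  have inv_lprod: "inv_into (\<Pi>\<^sub>E j\<in>{..<n}. single j ` T) (\<lambda>t. lprod W t n) m i = single i (fst m i)"
    if "m \<in> base T \<inter> H" "i < n" for m i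
    using that inv_into_lprod[OF T.subset] by blast
  have Hcos: "H \<in> rcosets\<^bsub>?G\<^esub> H"
    using G.rcosetsI[OF subgroup.subset[OF HG] G.one_closed] W.coset_mult_one[OF H.subset] by (simp add: rc)
  have neT: "single i ` A \<noteq> single i ` T" if i: "i < n" for i
    using A(3) by (simp only: inj_image_eq_iff[OF inj_single[OF i]] not_False_eq_True)
  have ne1: "single i ` A \<noteq> {\<one>\<^bsub>W\<^esub>}" if i: "i < n" for i
  proof -
    have "single i ` A \<noteq> single i ` {\<one>}" using A(4) by (simp only: inj_image_eq_iff[OF inj_single[OF i]] not_False_eq_True)
    then show ?thesis by (simp add: single_one)
  qed
  have surj: "(\<lambda>m. inv_into (\<Pi>\<^sub>E j\<in>{..<n}. single j ` T) (\<lambda>t. lprod W t n) m i) ` (base T \<inter> H)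
      = single i ` A" if i: "i < n" for i
  proof -
    have "(\<lambda>m. inv_into (\<Pi>\<^sub>E j\<in>{..<n}. single j ` T) (\<lambda>t. lprod W t n) m i) ` (base T \<inter> H)
        = (\<lambda>m. single i (fst m i)) ` (base T \<inter> H)"
      using inv_lprod[OF _ i] by (rule image_cong[OF refl])
    also have "\<dots> = single i ` A" using proj[OF i] by (simp only: image_image[symmetric, of "single i" "\<lambda>m. fst m i"])
    finally show ?thesis .
  qed
  have ninj: "\<exists>i<n. \<not> inj_on (\<lambda>m. inv_into (\<Pi>\<^sub>E j\<in>{..<n}. single j ` T) (\<lambda>t. lprod W t n) m i) (base T \<inter> H)"
  proof -
    obtain i x where ix: "i < n" "x \<in> base T \<inter> H" "x \<noteq> \<one>\<^bsub>W\<^esub>" "fst x i = \<one>" using ker by blast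
    have 1: "\<one>\<^bsub>W\<^esub> \<in> base T \<inter> H"
      using subgroup.one_closed[OF subgroup_base[OF T.subgroup_axioms]] H.one_closed by blast
    have "fst \<one>\<^bsub>W\<^esub> i = \<one>" using ix by (simp add: one_wreath)
    then show ?thesis
      using ix 1 inv_lprod[OF ix(2,1)] inv_lprod[OF 1 ix(1)] unfolding inj_on_def by metis
  qed
  have img: "base T \<inter> H \<subseteq> (\<lambda>t. lprod W t n) ` (\<Pi>\<^sub>E j\<in>{..<n}. single j ` A)"
    using sub bij_betw_imp_surj_on[OF bij_betw_lprod[OF Ac]] by blast
  have PA: "\<exists>(k::nat) Ts Rs. k \<ge> 2 \<and>
          (\<forall>i<k. subgroup (Ts i) ?G \<and> nonabelian_simple (?G\<lparr>carrier := Ts i\<rparr>)) \<and>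
          (\<forall>i<k. \<forall>j<k. ?G\<lparr>carrier := Ts i\<rparr> \<cong> ?G\<lparr>carrier := Ts j\<rparr>) \<and>
          (\<lambda>t. lprod ?G t k) \<in> iso (product_group {..<k} (\<lambda>i. ?G\<lparr>carrier := Ts i\<rparr>)) (?G\<lparr>carrier := base T\<rparr>) \<and>
          (\<exists>\<omega>\<in>rcosets\<^bsub>?G\<^esub> H.
             (\<forall>i<k. subgroup (Rs i) ?G \<and> Rs i \<subseteq> Ts i \<and> Rs i \<noteq> Ts i \<and> Rs i \<noteq> {\<one>\<^bsub>?G\<^esub>}) \<and>
             (\<forall>i<k. \<forall>j<k. ?G\<lparr>carrier := Rs i\<rparr> \<cong> ?G\<lparr>carrier := Rs j\<rparr>) \<and>
             {m \<in> base T. \<omega> #>\<^bsub>W\<^esub> m = \<omega>} \<subseteq> (\<lambda>t. lprod ?G t k) ` (\<Pi>\<^sub>E j\<in>{..<k}. Rs j) \<and>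
             (\<forall>i<k. (\<lambda>m. inv_into (\<Pi>\<^sub>E j\<in>{..<k}. Ts j) (\<lambda>t. lprod ?G t k) m i)
                        ` {m \<in> base T. \<omega> #>\<^bsub>W\<^esub> m = \<omega>} = Rs i) \<and>
             (\<exists>i<k. \<not> inj_on (\<lambda>m. inv_into (\<Pi>\<^sub>E j\<in>{..<k}. Ts j) (\<lambda>t. lprod ?G t k) m i)
                        {m \<in> base T. \<omega> #>\<^bsub>W\<^esub> m = \<omega>}))"
    apply (rule exI[of _ n], rule exI[of _ "\<lambda>i. single i ` T"], rule exI[of _ "\<lambda>i. single i ` A"])
    apply (intro conjI bexI[OF _ Hcos])
    unfolding lprod_carrier_update stab one
    subgoal by (rule n2)
    subgoal by (intro allI impI conjI sub_single T.subgroup_axioms simple_single subset_refl)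
    subgoal by (intro allI impI iso_single T.subgroup_axioms)
    subgoal using lprod_iso[OF T.subgroup_axioms] by simp
    subgoal by (intro allI impI conjI sub_single A(1,2) image_mono neT ne1)
    subgoal by (intro allI impI iso_single A(1))
    subgoal by (rule img)
    subgoal by (intro allI impI surj)
    subgoal by (rule ninj)
    done
  show ?thesis unfolding quasiprimitive_nondiagonal_PA_def
  proof (intro conjI)
    show "transitive_perm_group ?G (rcosets\<^bsub>?G\<^esub> H) (\<lambda>C g. C #>\<^bsub>W\<^esub> g)" by (rule trans)
    show "\<forall>N. minimal_normal ?G N \<longrightarrow>
        (\<forall>\<omega>\<in>rcosets\<^bsub>?G\<^esub> H. \<forall>\<omega>'\<in>rcosets\<^bsub>?G\<^esub> H. \<exists>g\<in>N. \<omega> #>\<^bsub>W\<^esub> g = \<omega>')"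
      using uniq tr by blast
  qed (rule exI[of _ "base T"], intro conjI allI impI minT uniq, assumption, rule PA)
qed

text \<open>Coordinate i of the k-th power is the product of k cyclically consecutive entries
  starting at i. As b and c commute, only the number of factors c matters, and one full turn meets
  the single entry without c exactly once, whatever i is; hence the exponent n - 1. Coordinates are
  counted from 0, so index 1 is the second one.\<close>

lemma twisted_cycle_pow:
  assumes b: "b \<in> carrier XG" and c: "c \<in> carrier XG" and comm: "b \<otimes> c = c \<otimes> b" and n: "n > 1"
  defines "d \<equiv> ((\<lambda>i\<in>{..<n}. if i = 1 then b else b \<otimes> c), 1::nat)"
  shows "d [^]\<^bsub>W\<^esub> n = ((\<lambda>i\<in>{..<n}. b [^] n \<otimes> c [^] (n - 1)), 0)"
proof -
  let ?e = "\<lambda>j. if j = 1 then 0 else 1 :: nat"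
  have d: "d \<in> carrier W" unfolding d_def carrier_wreath using b c n by simp
  have cb: "c [^] (k::nat) \<otimes> b = b \<otimes> c [^] k" for k
  proof (induction k)
    case (Suc k)
    then show ?case using b c comm by (metis m_assoc nat_pow_Suc nat_pow_closed)
  qed (use b in simp)
  have step: "fst (d [^]\<^bsub>W\<^esub> k) i = b [^] k \<otimes> c [^] (\<Sum>l<k. ?e ((i + l) mod n))" if i: "i < n" for i k
  proof (induction k)
    case 0
    then show ?case using i by (simp add: one_wreath)
  next
    case (Suc k)
    let ?j = "(i + k) mod n" and ?s = "\<Sum>l<k. ?e ((i + l) mod n)"
    have "snd (d [^]\<^bsub>W\<^esub> k) = k mod n" using snd_pow_wreath[OF d] by (simp add: d_def)
    then have "fst (d [^]\<^bsub>W\<^esub> Suc k) i = b [^] k \<otimes> c [^] ?s \<otimes> fst d ?j"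
      using i Suc by (simp add: fst_mult_wreath mod_add_right_eq)
    also have "fst d ?j = b \<otimes> c [^] ?e ?j" using n b c by (simp add: d_def)
    also have "b [^] k \<otimes> c [^] ?s \<otimes> (b \<otimes> c [^] ?e ?j) = b [^] k \<otimes> (c [^] ?s \<otimes> b) \<otimes> c [^] ?e ?j"
      using b c by (simp only: m_assoc nat_pow_closed m_closed)
    also have "\<dots> = (b [^] k \<otimes> b) \<otimes> (c [^] ?s \<otimes> c [^] ?e ?j)"
      unfolding cb using b c by (simp only: m_assoc nat_pow_closed m_closed)
    also have "\<dots> = b [^] Suc k \<otimes> c [^] (?s + ?e ?j)" using c by (simp only: nat_pow_Suc nat_pow_mult)
    finally show ?case by simp
  qed
  have "(\<Sum>j<n. ?e j) = n - 1"
  proof -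
    have "(\<Sum>j<n. ?e j) = (\<Sum>j\<in>{..<n} - {1}. 1)"
      using n by (subst sum.remove[of _ 1]) auto
    then show ?thesis using n by simp
  qed
  then have e: "(\<Sum>l<n. ?e ((i + l) mod n)) = n - 1" if "i < n" for i
    using sum_shift_mod[OF that, of ?e] by simp
  show ?thesis
  proof (rule wreath_eqI)
    show "d [^]\<^bsub>W\<^esub> n \<in> carrier W" using d by simp
    show "((\<lambda>i\<in>{..<n}. b [^] n \<otimes> c [^] (n - 1)), 0) \<in> carrier W"
      unfolding carrier_wreath using b c n by simp
    show "snd (d [^]\<^bsub>W\<^esub> n) = snd ((\<lambda>i\<in>{..<n}. b [^] n \<otimes> c [^] (n - 1)), 0::nat)"
      using snd_pow_wreath[OF d, of n] by simp
  next
    fix i assume i: "i < n"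
    show "fst (d [^]\<^bsub>W\<^esub> n) i = fst ((\<lambda>i\<in>{..<n}. b [^] n \<otimes> c [^] (n - 1)), 0::nat) i"
      unfolding step[OF i] e[OF i] using i by simp
  qed
qed

text \<open>If the minimal normal subgroup met the base group trivially, it would contain the nontrivial
  base element obtained as a commutator with an element supported on one coordinate.\<close>

lemma minimal_normal_subset_base:
  assumes S: "subgroup S W" "base F \<subseteq> S" and F: "subgroup F XG" "F \<noteq> {\<one>}"
    and E: "minimal_normal (W\<lparr>carrier := S\<rparr>) E" and proj: "\<And>e i. e \<in> E \<Longrightarrow> i < n \<Longrightarrow> fst e i \<in> F"
  shows "E \<subseteq> base F"
proof -
  let ?B = "base (carrier XG)"
  interpret S: subgroup S W by fact
  interpret G: group "W\<lparr>carrier := S\<rparr>" by (rule W.subgroup_imp_group[OF S(1)])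
  have En: "E \<lhd> (W\<lparr>carrier := S\<rparr>)" using E by (simp add: minimal_normal_def)
  have ES: "subgroup E (W\<lparr>carrier := S\<rparr>)" using normal_imp_subgroup[OF En] .
  interpret E: subgroup E W using W.incl_subgroup[OF S(1) ES] .
  \<comment> \<open>The full base group X^n is used because it is normal in all of W;
    \<open>normal_base\<close> would ask for F to be normal in X. The entries are put into F by
    \<open>proj\<close> only at the end.\<close>
  have B: "?B \<lhd> W" by (rule normal_base[OF normal_self])
  interpret B: normal ?B W by fact
  have "E \<inter> ?B \<lhd> (W\<lparr>carrier := S\<rparr>)" unfolding G.normal_inv_iff
  proof
    have "subgroup (E \<inter> ?B) W"
      by (rule W.subgroups_Inter_pair[OF E.subgroup_axioms B.subgroup_axioms])
    then show "subgroup (E \<inter> ?B) (W\<lparr>carrier := S\<rparr>)"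
      using subgroup.subset[OF ES] by (intro W.subgroup_incl[OF _ S(1)]) auto
    show "\<forall>x\<in>carrier (W\<lparr>carrier := S\<rparr>). \<forall>h\<in>E \<inter> ?B.
       x \<otimes>\<^bsub>W\<lparr>carrier := S\<rparr>\<^esub> h \<otimes>\<^bsub>W\<lparr>carrier := S\<rparr>\<^esub> inv\<^bsub>W\<lparr>carrier := S\<rparr>\<^esub> x \<in> E \<inter> ?B"
      using W.normal_conj_closed[OF S(1) En] B.inv_op_closed2
      by (simp add: W.m_inv_consistent[OF S(1)])
  qed
  then have "E \<inter> ?B = {\<one>\<^bsub>W\<^esub>} \<or> E \<inter> ?B = E"
    using E unfolding minimal_normal_def by simp
  then have snd0: "snd e = 0" if e: "e \<in> E" for e
  proof
    assume "E \<inter> ?B = E"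
    then have "e \<in> ?B" using e by blast
    then show ?thesis by (simp add: mem_base_iff)
  next
    assume triv: "E \<inter> ?B = {\<one>\<^bsub>W\<^esub>}"
    show ?thesis
    proof (rule ccontr)
      assume ne: "snd e \<noteq> 0"
      obtain a where a: "a \<in> F" "a \<noteq> \<one>" using F subgroup.one_closed by blast
      have ac: "a \<in> carrier XG" using subgroup.mem_carrier[OF F(1) a(1)] .
      define s where "s = single 0 a"
      have s: "s \<in> S" using single_mem_base[OF F(1) a(1)] S(2) by (auto simp: s_def)
      define m where "m = e \<otimes>\<^bsub>W\<^esub> s \<otimes>\<^bsub>W\<^esub> inv\<^bsub>W\<^esub> e \<otimes>\<^bsub>W\<^esub> inv\<^bsub>W\<^esub> s"
      have "e \<otimes>\<^bsub>W\<^esub> (s \<otimes>\<^bsub>W\<^esub> inv\<^bsub>W\<^esub> e \<otimes>\<^bsub>W\<^esub> inv\<^bsub>W\<^esub> s) \<in> E"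
        using e s W.normal_conj_closed[OF S(1) En, of s "inv\<^bsub>W\<^esub> e"] by simp
      then have mE: "m \<in> E" using e s by (simp add: m_def W.m_assoc)
      have m: "snd m = 0" "fst m 0 = inv a"
        using commutator_single[OF E.mem_carrier[OF e] ne ac] by (simp_all only: m_def s_def)
      have "m \<in> E \<inter> ?B" using mE m(1) by (simp add: mem_base_iff fst_wreath_closed)
      then have "m = \<one>\<^bsub>W\<^esub>" using triv by blast
      then have "inv a = \<one>" using m(2) n_pos by (simp add: one_wreath)
      then show False using a ac by (simp add: inv_eq_1_iff)
    qed
  qed
  show ?thesis using snd0 proj by (auto simp: mem_base_iff[OF subgroup.subset[OF F(1)]])
qed

end

section \<open>The coset action of T^n with the twisted cycle\<close>

theorem theorem6p3:
  fixes p f q n s r t :: nat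
    and XG :: "('a, 'b) monoid_scheme" and T R F :: "'a set" and b c :: "'a"
    and K :: "('k, 'm) ring_scheme"
    and E :: "((nat \<Rightarrow> 'a) \<times> nat) set"
  defines "W \<equiv> wreath_cyc XG n"
  defines "d0 \<equiv> (\<lambda>i\<in>{..<n}. if i = 1 then b else b \<otimes>\<^bsub>XG\<^esub> c)"
  defines "\<theta> \<equiv> (d0, 1::nat)"
  defines "Tn \<equiv> ({..<n} \<rightarrow>\<^sub>E T) \<times> {0::nat}"
  defines "Fn \<equiv> ({..<n} \<rightarrow>\<^sub>E F) \<times> {0::nat}"
  defines "G \<equiv> generate W (Tn \<union> {\<theta>})"
  defines "FnTheta \<equiv> generate W (Fn \<union> {\<theta>})"
  defines "H \<equiv> generate W (E \<union> {\<theta>})"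
  assumes C1: "Factorial_Ring.prime p" "f \<ge> 1" "q = p ^ f" "n = q + 1" "n = 2 ^ s * r ^ t" "n > 3"
      "Factorial_Ring.prime r" "odd r" "s \<ge> 2 \<or> even q"
    and C2: "almost_simple_socle XG T" "card (carrier XG) \<le> 2 * card T"
      "subgroup R XG" "field K" "card (carrier K) = q" "XG\<lparr>carrier := R\<rparr> \<cong> AGL1 K"
      "normal F (XG\<lparr>carrier := R\<rparr>)" "XG\<lparr>carrier := F\<rparr> \<cong> elem_ab p f"
      "b \<in> R" "c \<in> R"
      "group.ord XG b = (q - 1) div gcd 2 (q - 1)" "group.ord XG c = gcd 2 (q - 1)"
      "b \<otimes>\<^bsub>XG\<^esub> c = c \<otimes>\<^bsub>XG\<^esub> b"
      "generate XG {b} \<inter> generate XG {c} = {\<one>\<^bsub>XG\<^esub>}"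
      "F \<inter> generate XG {b, c} = {\<one>\<^bsub>XG\<^esub>}"
      "F <#>\<^bsub>XG\<^esub> generate XG {b, c} = R"
    and E1: "minimal_normal (W\<lparr>carrier := FnTheta\<rparr>) E" "W\<lparr>carrier := E\<rparr> \<cong> elem_ab p (2 * f)"
    and E2: "\<forall>x\<in>E - {\<one>\<^bsub>W\<^esub>}. \<forall>y\<in>E - {\<one>\<^bsub>W\<^esub>}. \<exists>k::nat.
               inv\<^bsub>W\<^esub> (\<theta> [^]\<^bsub>W\<^esub> k) \<otimes>\<^bsub>W\<^esub> x \<otimes>\<^bsub>W\<^esub> (\<theta> [^]\<^bsub>W\<^esub> k) = y"
    and E3: "\<forall>i<n. (\<lambda>e. fst e i) ` E = F"
      "\<forall>i<n. \<forall>j<n. i < j \<longrightarrow> {e \<in> E. fst e i = \<one>\<^bsub>XG\<^esub>} \<noteq> {e \<in> E. fst e j = \<one>\<^bsub>XG\<^esub>}"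
  shows "quasiprimitive_nondiagonal_PA (W\<lparr>carrier := G\<rparr>) (rcosets\<^bsub>W\<lparr>carrier := G\<rparr>\<^esub> H)
           (\<lambda>S g. S #>\<^bsub>W\<^esub> g)
         \<and> Tn \<inter> H \<subseteq> ({..<n} \<rightarrow>\<^sub>E (R \<inter> T)) \<times> {0}
         \<and> (\<forall>i<n. (\<lambda>x. fst x i) ` (Tn \<inter> H) = R \<inter> T)"
proof -
  have grp: "group XG" and finX: "finite (carrier XG)" and TX: "T \<lhd> XG"
    and simp_T: "nonabelian_simple (XG\<lparr>carrier := T\<rparr>)" and cent: "centralizer XG T = {\<one>\<^bsub>XG\<^esub>}"
    using C2(1) by (auto simp: almost_simple_socle_def)
  interpret cw: cyclic_wreath XG n
    using grp C1(6) by (simp add: cyclic_wreath_def cyclic_wreath_axioms_def)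
  interpret T: normal T XG by fact
  interpret R: subgroup R XG by fact
  have W: "W = cw.W" by (simp add: W_def)
  have Tn: "Tn = cw.base T" and Fn: "Fn = cw.base F" by (simp_all add: Tn_def Fn_def cw.base_def)
  have b: "b \<in> carrier XG" and c: "c \<in> carrier XG" using C2(9,10) by auto
  have FR: "F \<subseteq> R" using subgroup.subset[OF normal_imp_subgroup[OF C2(7)]] by simp
  have Fsub: "subgroup F XG" using cw.incl_subgroup[OF C2(3) normal_imp_subgroup[OF C2(7)]] .
  interpret F: subgroup F XG by fact
  have Fcomm: "x \<otimes>\<^bsub>XG\<^esub> y = y \<otimes>\<^bsub>XG\<^esub> x" if "x \<in> F" "y \<in> F" for x y
    using iso_comm_group_imp_commute[OF C2(8) comm_group_elem_ab, of x y] that by simp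
  \<comment> \<open>With F trivial, every projection would have kernel E, against the distinct
    kernels.\<close>
  have Fne: "F \<noteq> {\<one>\<^bsub>XG\<^esub>}"
  proof
    assume F1: "F = {\<one>\<^bsub>XG\<^esub>}"
    have "{e \<in> E. fst e i = \<one>\<^bsub>XG\<^esub>} = E" if "i < n" for i
      using E3(1) that unfolding F1 by blast
    then have "{e \<in> E. fst e 0 = \<one>\<^bsub>XG\<^esub>} = {e \<in> E. fst e 1 = \<one>\<^bsub>XG\<^esub>}" using C1(6) by simp
    then show False using E3(2) C1(6) by auto
  qed
  \<comment> \<open>This provides the scalar besides 0 and 1 that makes every translation a
    commutator.\<close>
  have q2: "q > 2" using C1(4,6) by simp
  have FT: "F \<subseteq> T"
  proof
    fix g assume g: "g \<in> F"
    obtain x y where "x \<in> R" "y \<in> R" "x \<otimes>\<^bsub>XG\<^esub> y = g \<otimes>\<^bsub>XG\<^esub> (y \<otimes>\<^bsub>XG\<^esub> x)"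
      using cw.abelian_normal_AGL1_commutator[OF C2(3,4) _ C2(6,7) Fcomm g] C2(5) q2 by auto
    then show "g \<in> T"
      using cw.index_two_commutator_mem[OF TX finX C2(2), of x y g] g by simp
  qed
  have base_mono: "cw.base F \<subseteq> cw.base T"
    unfolding cw.base_def using FT by (intro Sigma_mono PiE_mono) auto
  have \<theta>: "\<theta> \<in> carrier cw.W"
    unfolding \<theta>_def d0_def cw.carrier_wreath using b c C1(6) by simp
  have pow_mem: "x [^]\<^bsub>cw.W\<^esub> (k::nat) \<in> S" if "subgroup S cw.W" "x \<in> S" for S x k
    using that by (induction k) (auto intro: subgroup.one_closed subgroup.m_closed)
  have snd\<theta>: "snd (\<theta> [^]\<^bsub>cw.W\<^esub> k) = k mod n" for k :: nat
    using cw.snd_pow_wreath[OF \<theta>, of k] by (simp add: \<theta>_def)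
  have Tc: "cw.base T \<subseteq> carrier cw.W" using subgroup.subset[OF cw.subgroup_base[OF T.subgroup_axioms]] .
  have Fc: "cw.base F \<subseteq> carrier cw.W" using base_mono Tc by blast
  have Gsub: "subgroup G cw.W" unfolding G_def W Tn
    using Tc \<theta> by (intro cw.W.generate_is_subgroup) simp
  have FTsub: "subgroup FnTheta cw.W" unfolding FnTheta_def W Fn
    using Fc \<theta> by (intro cw.W.generate_is_subgroup) simp
  have TG: "cw.base T \<subseteq> G" unfolding G_def Tn by (auto intro: generate.incl)
  have FG: "cw.base F \<subseteq> FnTheta" unfolding FnTheta_def Fn by (auto intro: generate.incl)
  have \<theta>G: "\<theta> \<in> G" unfolding G_def by (auto intro: generate.incl)
  have Eproj: "fst e i \<in> F" if "e \<in> E" "i < n" for e i using E3(1) that by blast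
  have EF: "E \<subseteq> cw.base F"
    by (rule cw.minimal_normal_subset_base[OF FTsub FG Fsub Fne E1(1)[unfolded W] Eproj])
  then have Ec: "E \<subseteq> carrier cw.W" using Fc by blast
  have oneE: "\<one>\<^bsub>cw.W\<^esub> \<in> E"
  proof -
    have "subgroup E (W\<lparr>carrier := FnTheta\<rparr>)"
      using E1(1) normal_imp_subgroup by (auto simp: minimal_normal_def)
    then show ?thesis using subgroup.one_closed W by fastforce
  qed
  have Hsub: "subgroup H cw.W" unfolding H_def W
    using Ec \<theta> by (intro cw.W.generate_is_subgroup) simp
  interpret H: subgroup H cw.W by fact
  have EH: "E \<subseteq> H" and \<theta>H: "\<theta> \<in> H" unfolding H_def by (auto intro: generate.incl)
  have HG: "H \<subseteq> G" unfolding H_def W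
    using EF base_mono TG \<theta>G by (intro cw.W.generate_subgroup_incl[OF _ Gsub]) blast
  have G_TH: "G \<subseteq> cw.base T <#>\<^bsub>cw.W\<^esub> H"
  proof -
    \<comment> \<open>T^n is normal in W because T is normal in X, so its product with H is a
      subgroup; containing T^n and \<theta>, it contains G.\<close>
    have sub: "subgroup (cw.base T <#>\<^bsub>cw.W\<^esub> H) cw.W"
      using cw.W.mult_norm_subgroup[OF cw.normal_base[OF TX] Hsub] .
    have "x \<in> cw.base T <#>\<^bsub>cw.W\<^esub> H" if x: "x \<in> cw.base T" for x
    proof -
      have "x = x \<otimes>\<^bsub>cw.W\<^esub> \<one>\<^bsub>cw.W\<^esub>" using x Tc by auto
      then show ?thesis unfolding set_mult_def using x H.one_closed by blast
    qed
    moreover have "\<theta> \<in> cw.base T <#>\<^bsub>cw.W\<^esub> H"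
    proof -
      have "\<theta> = \<one>\<^bsub>cw.W\<^esub> \<otimes>\<^bsub>cw.W\<^esub> \<theta>" using \<theta> by simp
      then show ?thesis unfolding set_mult_def
        using \<theta>H subgroup.one_closed[OF cw.subgroup_base[OF T.subgroup_axioms]] by blast
    qed
    ultimately show ?thesis unfolding G_def W Tn
      by (intro cw.W.generate_subgroup_incl[OF _ sub]) blast
  qed
  \<comment> \<open>The required rotation is by i - j modulo n, written with n - j to stay within
    the naturals.\<close>
  have rot: "\<exists>g\<in>G. (j + snd g) mod n = i" if ij: "i < n" "j < n" for i j
  proof
    show "\<theta> [^]\<^bsub>cw.W\<^esub> (i + (n - j)) \<in> G"
      using \<theta>G pow_mem[OF Gsub] by blast
    have "(j + (i + (n - j)) mod n) mod n = (j + (i + (n - j))) mod n" by (rule mod_add_right_eq)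
    also have "j + (i + (n - j)) = i + n" using ij by simp
    finally show "(j + snd (\<theta> [^]\<^bsub>cw.W\<^esub> (i + (n - j)))) mod n = i" using ij by (simp add: snd\<theta>)
  qed
  have Asub: "subgroup (R \<inter> T) XG"
    using cw.subgroups_Inter_pair[OF C2(3) T.subgroup_axioms] .
  \<comment> \<open>If T were contained in R, then F would be normal in T, hence equal to T by
    simplicity; but F is abelian.\<close>
  have AneT: "R \<inter> T \<noteq> T"
  proof
    assume "R \<inter> T = T"
    then have TR: "T \<subseteq> R" by blast
    interpret TS: simple_group "XG\<lparr>carrier := T\<rparr>" using simp_T by (simp add: nonabelian_simple_def)
    have "F \<lhd> (XG\<lparr>carrier := T\<rparr>)" unfolding TS.normal_inv_iff
    proof
      show "subgroup F (XG\<lparr>carrier := T\<rparr>)"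
        by (rule cw.subgroup_incl[OF Fsub T.subgroup_axioms FT])
      show "\<forall>x\<in>carrier (XG\<lparr>carrier := T\<rparr>). \<forall>h\<in>F. x \<otimes>\<^bsub>XG\<lparr>carrier := T\<rparr>\<^esub> h
          \<otimes>\<^bsub>XG\<lparr>carrier := T\<rparr>\<^esub> inv\<^bsub>XG\<lparr>carrier := T\<rparr>\<^esub> x \<in> F"
        using cw.normal_conj_closed[OF C2(3) C2(7)] TR
        by (simp add: cw.m_inv_consistent[OF T.subgroup_axioms] subset_iff)
    qed
    then have "F = T" using TS.no_real_normal_subgroup[of F] Fne by simp
    then have "comm_group (XG\<lparr>carrier := T\<rparr>)"
      using Fcomm by (intro TS.group_comm_groupI) simp
    then show False using simp_T by (simp add: nonabelian_simple_def)
  qed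
  have Ane1: "R \<inter> T \<noteq> {\<one>\<^bsub>XG\<^esub>}" using Fne F.one_closed FR FT by blast
  have Hcoord: "H \<subseteq> {g \<in> carrier cw.W. \<forall>i<n. fst g i \<in> R}"
    unfolding H_def W
  proof (rule cw.W.generate_subgroup_incl[OF _ cw.subgroup_coordinates[OF C2(3)]])
    have "\<theta> \<in> {g \<in> carrier cw.W. \<forall>i<n. fst g i \<in> R}"
      using \<theta> C2(9,10) by (simp add: \<theta>_def d0_def)
    then show "E \<union> {\<theta>} \<subseteq> {g \<in> carrier cw.W. \<forall>i<n. fst g i \<in> R}"
      using Ec Eproj FR by blast
  qed
  have sub: "cw.base T \<inter> H \<subseteq> cw.base (R \<inter> T)"
  proof
    fix g assume "g \<in> cw.base T \<inter> H"
    then show "g \<in> cw.base (R \<inter> T)"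
      using Hcoord by (auto simp: cw.mem_base_iff[OF T.subset] cw.mem_base_iff[OF subgroup.subset[OF Asub]])
  qed
  have diag: "((\<lambda>i\<in>{..<n}. h), 0) \<in> H" if h: "h \<in> generate XG {b, c}" for h
  proof -
    define y where "y = b [^]\<^bsub>XG\<^esub> (q + 1) \<otimes>\<^bsub>XG\<^esub> c [^]\<^bsub>XG\<^esub> q"
    have y: "y \<in> carrier XG" using b c by (simp add: y_def)
    \<comment> \<open>For odd q the condition s \<ge> 2 gives 4 | n = q + 1, the origin of the odd
      order of b.\<close>
    have "even q \<or> 4 dvd q + 1"
    proof (cases "even q")
      case False
      then have "(2::nat) ^ 2 dvd 2 ^ s" using C1(9) by (intro le_imp_power_dvd) blast
      then have "(2::nat) ^ 2 dvd n" unfolding C1(5) by (rule dvd_mult2)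
      then show ?thesis using C1(4) by simp
    qed simp
    then have "h \<in> generate XG {y}"
      using cw.generate_pair_subset_generate_mult[OF b c C2(13) C2(11,12)] q2 h unfolding y_def by auto
    then obtain k :: nat where k: "h = y [^]\<^bsub>XG\<^esub> k"
      using cw.generate_pow_on_finite_carrier[OF finX y] by auto
    have "\<theta> [^]\<^bsub>cw.W\<^esub> n = ((\<lambda>i\<in>{..<n}. y), 0)"
      using cw.twisted_cycle_pow[OF b c C2(13)] C1(4,6) by (simp add: \<theta>_def d0_def y_def)
    then have "(\<theta> [^]\<^bsub>cw.W\<^esub> n) [^]\<^bsub>cw.W\<^esub> k = ((\<lambda>i\<in>{..<n}. h), 0)"
      using cw.diagonal_pow[OF y] k by simp
    then show ?thesis using pow_mem[OF Hsub pow_mem[OF Hsub \<theta>H]] by metis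
  qed
  have proj: "(\<lambda>x. fst x i) ` (cw.base T \<inter> H) = R \<inter> T" if i: "i < n" for i
  proof
    show "(\<lambda>x. fst x i) ` (cw.base T \<inter> H) \<subseteq> R \<inter> T"
      using sub i by (auto simp: cw.mem_base_iff[OF subgroup.subset[OF Asub]])
    show "R \<inter> T \<subseteq> (\<lambda>x. fst x i) ` (cw.base T \<inter> H)"
    proof
      \<comment> \<open>In x = gh with g in F and h in \<langle>b, c\<rangle>, the factor g is
        already in T, hence so is h; it need not be known which elements of \<langle>b, c\<rangle>
        lie in T. Then x is coordinate i of a product of an element of E, chosen to be g there, and
        the diagonal element of h.\<close>
      fix x assume x: "x \<in> R \<inter> T"
      then obtain g h where gh: "g \<in> F" "h \<in> generate XG {b, c}" "x = g \<otimes>\<^bsub>XG\<^esub> h"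
        using C2(16) by (auto simp: set_mult_def)
      have hc: "h \<in> carrier XG" using gh(2) cw.generate_in_carrier[of "{b, c}" h] b c by blast
      have "h = inv\<^bsub>XG\<^esub> g \<otimes>\<^bsub>XG\<^esub> x" using gh hc by (simp add: cw.m_assoc[symmetric])
      then have hT: "h \<in> T" using x gh(1) FT by auto
      obtain e where e: "e \<in> E" "fst e i = g" using E3(1) i gh(1) by blast
      let ?d = "((\<lambda>i\<in>{..<n}. h), 0::nat)"
      have "?d \<in> cw.base T" using hT by (simp add: cw.base_def)
      moreover have "e \<in> cw.base T" using e EF base_mono by blast
      ultimately have "e \<otimes>\<^bsub>cw.W\<^esub> ?d \<in> cw.base T"
        using subgroup.m_closed[OF cw.subgroup_base[OF T.subgroup_axioms]] by blast
      moreover have "e \<otimes>\<^bsub>cw.W\<^esub> ?d \<in> H" using e EH diag[OF gh(2)] by blast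
      moreover have "fst (e \<otimes>\<^bsub>cw.W\<^esub> ?d) i = x"
        using i e gh(3) by (simp add: cw.fst_mult_wreath)
      ultimately show "x \<in> (\<lambda>x. fst x i) ` (cw.base T \<inter> H)" by blast
    qed
  qed
  have ker: "\<exists>i<n. \<exists>x\<in>cw.base T \<inter> H. x \<noteq> \<one>\<^bsub>cw.W\<^esub> \<and> fst x i = \<one>\<^bsub>XG\<^esub>"
  proof (rule ccontr)
    assume no: "\<not> ?thesis"
    have "{e \<in> E. fst e i = \<one>\<^bsub>XG\<^esub>} = {\<one>\<^bsub>cw.W\<^esub>}" if i: "i < n" for i
    proof -
      have "fst \<one>\<^bsub>cw.W\<^esub> i = \<one>\<^bsub>XG\<^esub>" using i by (simp add: cw.one_wreath)
      moreover have "e = \<one>\<^bsub>cw.W\<^esub>" if "e \<in> E" "fst e i = \<one>\<^bsub>XG\<^esub>" for e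
        using no i that EF base_mono EH by blast
      ultimately show ?thesis using oneE by blast
    qed
    then have "{e \<in> E. fst e 0 = \<one>\<^bsub>XG\<^esub>} = {e \<in> E. fst e 1 = \<one>\<^bsub>XG\<^esub>}" using C1(6) by simp
    then show False using E3(2) C1(6) by auto
  qed
  have n2: "n \<ge> 2" using C1(6) by simp
  have "quasiprimitive_nondiagonal_PA (cw.W\<lparr>carrier := G\<rparr>) (rcosets\<^bsub>cw.W\<lparr>carrier := G\<rparr>\<^esub> H)
      (\<lambda>S g. S #>\<^bsub>cw.W\<^esub> g)"
    by (rule cw.quasiprimitive_nondiagonal_PA_wreath[OF TX simp_T cent n2 Gsub TG rot Hsub HG G_TH
        Asub Int_lower2 AneT Ane1 sub proj ker])
  then show ?thesis
    using sub proj unfolding W Tn cw.base_def by blast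
qed

end
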